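(* Let the Pick matrix $P$ of an interpolation data set be invertible, write $P^{-1}=[\tilde p_{ij}]_{i,j=1}^n$, and let $x_{i_1},\dots,x_{i_k}$ be distinct interpolation nodes. There exists a function $\varphi\in\widetilde{\mathbf{N}}_0$ satisfying conditions $\mathbf C_{4-6}\vee\widetilde{\mathbf C}_{4-6}$ at $x_{i_1},\dots,x_{i_k}$ if and only if the $k\times k$ matrix $$\mathcal{P}:=[\tilde p_{i_\alpha,i_\beta}]_{\alpha,\beta=1}^k$$ is negative semidefinite. In this case, if $\mathcal{P}$ is invertible, then there are infinitely many such functions, and if $\mathcal{P}$ is singular, then there is a unique such function.
   Context: Classes. $\mathbb{C}^+$ is the open upper half plane. $\mathbf{N}_0$ is the Nevanlinna class (functions analytic on $\mathbb{C}^+$ with nonnegative imaginary part) and $\widetilde{\mathbf{N}}_0=\mathbf{N}_0\cup\{\infty\}$, where $\infty$ is the function identically $\infty$. Boundary limits. For $x\in\mathbb{R}$, $f(x)$, $f'(x)$, $f_{-1}(x)$ denote the nontangential limits as $z\to x$ of $f(z)$, $f'(z)$, $(z-x)f(z)$, when they exist. If $f\equiv\infty$, then $f_{-1}(x)=\infty$; $1/\infty=0$. Data. $x_1,\dots,x_n$ are distinct real numbers (nodes), $0\le\ell\le n$, $w_j,\gamma_j\in\mathbb{R}$ $(1\le j\le\ell)$, $\xi_k\in\mathbb{R}\setminus\{0\}$ $(\ell<k\le n)$. The Pick matrix $P=[p_{ij}]_{i,j=1}^n$ is the real symmetric matrix with: $p_{ij}=\frac{w_j-w_i}{x_j-x_i}$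 for $i\ne j$ and $p_{ii}=\gamma_i$, for $i,j\le\ell$; $p_{ij}=p_{ji}=\frac{\xi_j}{x_j-x_i}$ for $i\le\ell<j$; $p_{ii}=-\xi_i$ and $p_{ij}=0$ $(i\neq j)$ for $i,j>\ell$. Also $C=[w_1\ \cdots\ w_\ell\ \xi_{\ell+1}\ \cdots\ \xi_n]$, $E=[1\ \cdots\ 1\ 0\ \cdots\ 0]$ ($\ell$ ones). Let $\tilde c_i$, $\tilde e_i$ be the $i$-th entries of the row vectors $CP^{-1}$, $EP^{-1}$ (real, not both zero), and $\eta_i=\tilde c_i/\tilde e_i$. $\varphi\in\widetilde{\mathbf{N}}_0$ satisfies $\mathbf C_{4-6}\vee\widetilde{\mathbf C}_{4-6}$ at $x_i$ if one of the following holds. When $\tilde e_i\neq0$: $\mathbf C_4$: $\varphi(x_i)=\eta_i$ and $0\le\varphi'(x_i)<-\tilde p_{ii}/\tilde e_i^2$; $\mathbf C_5$: $\varphi(x_i)=\eta_i$ and $\varphi'(x_i)=-\tilde p_{ii}/\tilde e_i^2>0$; $\mathbf C_6$: $\varphi(x_i)=\eta_i$ and $\varphi'(x_i)=\tilde p_{ii}=0$. When $\tilde e_i=0$: $\widetilde{\mathbf C}_4$: $\varphi(x_i)=\infty$ and $0\le-1/\varphi_{-1}(x_i)<-\tilde p_{ii}/\tilde c_i^2$; $\widetilde{\mathbf C}_5$: $\varphi(x_i)=\infty$ and $1/\varphi_{-1}(x_i)=\tilde p_{ii}/\tilde c_i^2<0$; $\widetilde{\mathbf C}_6$: $\varphi(x_i)=\infty$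 and $1/\varphi_{-1}(x_i)=\tilde p_{ii}=0$. *)

theory Defs
  imports "HOL-Complex_Analysis.Complex_Analysis" "Jordan_Normal_Form.Matrix"
begin

definition upper_half_plane :: "complex set" where
  "upper_half_plane = {z. Im z > 0}"

(* Functions are extensional (i.e. "undefined" off the half plane), so that equality of
   elements of the class, and hence counting them, is equality of functions on the half plane. *)
definition nevanlinna :: "(complex \<Rightarrow> complex) set" where
  "nevanlinna = {f \<in> extensional upper_half_plane.
     f analytic_on upper_half_plane \<and> (\<forall>z\<in>upper_half_plane. Im (f z) \<ge> 0)}"

(* None stands for the function identically infinity. *)
definition ext_nevanlinna :: "(complex \<Rightarrow> complex) option set" where
  "ext_nevanlinna = insert None (Some ` nevanlinna)"

definition stolz_angle :: "real \<Rightarrow> real \<Rightarrow> complex set" where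
  "stolz_angle x M = {z. Im z > 0 \<and> \<bar>Re z - x\<bar> \<le> M * Im z}"

(* Limits take values in the extended plane "complex option"; None is the point at infinity. *)
fun has_nt_limit :: "(complex \<Rightarrow> complex) \<Rightarrow> real \<Rightarrow> complex option \<Rightarrow> bool" where
  "has_nt_limit f x (Some L) \<longleftrightarrow>
     (\<forall>M>0. (f \<longlongrightarrow> L) (at (complex_of_real x) within stolz_angle x M))"
| "has_nt_limit f x None \<longleftrightarrow>
     (\<forall>M>0. filterlim f at_infinity (at (complex_of_real x) within stolz_angle x M))"

fun has_boundary_value :: "(complex \<Rightarrow> complex) option \<Rightarrow> real \<Rightarrow> complex option \<Rightarrow> bool" where
  "has_boundary_value (Some f) x v \<longleftrightarrow> has_nt_limit f x v"
| "has_boundary_value None x v \<longleftrightarrow> v = None"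

fun has_boundary_deriv :: "(complex \<Rightarrow> complex) option \<Rightarrow> real \<Rightarrow> complex option \<Rightarrow> bool" where
  "has_boundary_deriv (Some f) x v \<longleftrightarrow> has_nt_limit (deriv f) x v"
| "has_boundary_deriv None x v \<longleftrightarrow> False"

(* has_boundary_residue f x v: the limit f_{-1}(x) of (z - x) f(z) exists and is v. *)
fun has_boundary_residue :: "(complex \<Rightarrow> complex) option \<Rightarrow> real \<Rightarrow> complex option \<Rightarrow> bool" where
  "has_boundary_residue (Some f) x v \<longleftrightarrow> has_nt_limit (\<lambda>z. (z - complex_of_real x) * f z) x v"
| "has_boundary_residue None x v \<longleftrightarrow> v = None"

(* Reciprocal on the extended plane; in particular 1/0 is infinity here, not 0. *)
fun ext_recip :: "complex option \<Rightarrow> complex option" where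
  "ext_recip None = Some 0"
| "ext_recip (Some z) = (if z = 0 then None else Some (1 / z))"

(* Indices run from 0: i < l are the first-kind nodes, l \<le> i < n the second-kind ones. *)
definition interpolation_data :: "nat \<Rightarrow> nat \<Rightarrow> (nat \<Rightarrow> real) \<Rightarrow> (nat \<Rightarrow> real) \<Rightarrow> bool" where
  "interpolation_data n l x \<xi> \<longleftrightarrow>
     l \<le> n \<and> inj_on x {..<n} \<and> (\<forall>k. l \<le> k \<and> k < n \<longrightarrow> \<xi> k \<noteq> 0)"

definition pick_matrix ::
  "nat \<Rightarrow> nat \<Rightarrow> (nat \<Rightarrow> real) \<Rightarrow> (nat \<Rightarrow> real) \<Rightarrow> (nat \<Rightarrow> real) \<Rightarrow> (nat \<Rightarrow> real) \<Rightarrow> real mat" where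
  "pick_matrix n l x w \<gamma> \<xi> = Matrix.mat n n (\<lambda>(i, j).
     if i < l \<and> j < l then (if i = j then \<gamma> i else (w j - w i) / (x j - x i))
     else if i < l then \<xi> j / (x j - x i)
     else if j < l then \<xi> i / (x i - x j)
     else if i = j then - \<xi> i else 0)"

definition C_vec :: "nat \<Rightarrow> nat \<Rightarrow> (nat \<Rightarrow> real) \<Rightarrow> (nat \<Rightarrow> real) \<Rightarrow> real Matrix.vec" where
  "C_vec n l w \<xi> = Matrix.vec n (\<lambda>j. if j < l then w j else \<xi> j)"

definition E_vec :: "nat \<Rightarrow> nat \<Rightarrow> real Matrix.vec" where
  "E_vec n l = Matrix.vec n (\<lambda>j. if j < l then 1 else 0)"

definition row_times_mat :: "real Matrix.vec \<Rightarrow> real mat \<Rightarrow> real Matrix.vec" where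
  "row_times_mat v A = Matrix.row (mat_of_row v * A) 0"

(* In the following conditions x is the node x_i, and p, c, e are the i-th diagonal entry of the
   inverse Pick matrix and the i-th entries of C P^-1 and E P^-1. *)

definition cond_C4 where
  "cond_C4 x p c e \<phi> \<longleftrightarrow> e \<noteq> 0 \<and> has_boundary_value \<phi> x (Some (complex_of_real (c / e))) \<and>
     (\<exists>d::real. has_boundary_deriv \<phi> x (Some (complex_of_real d)) \<and> 0 \<le> d \<and> d < - p / e\<^sup>2)"

definition cond_C5 where
  "cond_C5 x p c e \<phi> \<longleftrightarrow> e \<noteq> 0 \<and> has_boundary_value \<phi> x (Some (complex_of_real (c / e))) \<and>
     has_boundary_deriv \<phi> x (Some (complex_of_real (- p / e\<^sup>2))) \<and> - p / e\<^sup>2 > 0"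

definition cond_C6 where
  "cond_C6 x p c e \<phi> \<longleftrightarrow> e \<noteq> 0 \<and> has_boundary_value \<phi> x (Some (complex_of_real (c / e))) \<and>
     has_boundary_deriv \<phi> x (Some (complex_of_real p)) \<and> p = 0"

definition cond_C4_tilde where
  "cond_C4_tilde x p c e \<phi> \<longleftrightarrow> e = 0 \<and> has_boundary_value \<phi> x None \<and>
     (\<exists>r. \<exists>t::real. has_boundary_residue \<phi> x r \<and> ext_recip r = Some (complex_of_real t) \<and>
        0 \<le> - t \<and> - t < - p / c\<^sup>2)"

definition cond_C5_tilde where
  "cond_C5_tilde x p c e \<phi> \<longleftrightarrow> e = 0 \<and> has_boundary_value \<phi> x None \<and>
     (\<exists>r. has_boundary_residue \<phi> x r \<and> ext_recip r = Some (complex_of_real (p / c\<^sup>2))) \<and> p / c\<^sup>2 < 0"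

definition cond_C6_tilde where
  "cond_C6_tilde x p c e \<phi> \<longleftrightarrow> e = 0 \<and> has_boundary_value \<phi> x None \<and>
     (\<exists>r. has_boundary_residue \<phi> x r \<and> ext_recip r = Some (complex_of_real p)) \<and> p = 0"

definition cond_C46 ::
  "real \<Rightarrow> real \<Rightarrow> real \<Rightarrow> real \<Rightarrow> (complex \<Rightarrow> complex) option \<Rightarrow> bool" where
  "cond_C46 x p c e \<phi> \<longleftrightarrow>
     cond_C4 x p c e \<phi> \<or> cond_C5 x p c e \<phi> \<or> cond_C6 x p c e \<phi> \<or>
     cond_C4_tilde x p c e \<phi> \<or> cond_C5_tilde x p c e \<phi> \<or> cond_C6_tilde x p c e \<phi>"

definition negative_semidefinite :: "real mat \<Rightarrow> bool" where
  "negative_semidefinite A \<longleftrightarrow> transpose_mat A = A \<and>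
     (\<forall>v \<in> carrier_vec (dim_row A). scalar_prod v (A *\<^sub>v v) \<le> 0)"

end

theory Submission
  imports Defs "Jordan_Normal_Form.Determinant"
begin

text \<open>
  The bound \<open>\<bar>e \<phi>(z) - c\<bar>\<^sup>2 / \<bar>z - x\<bar>\<^sup>2 \<le> g Im \<phi>(z) / Im z\<close> on the upper half plane encodes, by the
  Julia--Caratheodory theorem, both \<open>\<phi>(x) = c / e\<close> and \<open>\<phi>'(x) \<le> g / e\<^sup>2\<close>, and also the
  corresponding residue condition when \<open>e = 0\<close>; it is invariant under real Moebius maps acting on
  \<open>\<phi>\<close> and on the pair \<open>(c, e)\<close>. For \<open>C P\<^sup>-\<^sup>1\<close> and \<open>E P\<^sup>-\<^sup>1\<close>, the displacement equation of \<open>P\<close> turns \<open>- P\<^sup>-\<^sup>1\<close> into the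
  Pick matrix of such a problem. After moving the value at one node to infinity, subtracting
  the pole \<open>- (c\<^sup>2 / g) / (z - x)\<close> from \<open>\<phi>\<close> removes that node and replaces the Pick matrix by its
  Schur complement, so existence, uniqueness and abundance of solutions follow by induction on the
  number of nodes; the induction stops at a node with \<open>g = 0\<close>, where only the constant \<open>\<infinity>\<close> is left.
\<close>

subsection \<open>The Schwarz--Pick inequality\<close>

text \<open>The prescribed conditions mix limits of values, derivatives and residues and split
  according to whether the value is finite, and Moebius maps do not respect that split. An
  inequality over the whole half plane does: it reads the value \<open>c / e\<close> in homogeneous
  coordinates, and a rotation acts on it exactly, with no limit to recompute. Its weakness is
  addition: adding a pole to \<phi> changes its left side nonlinearly, whereas limits simply add.
  Hence both faces are needed, and their equivalence is derived from the Schwarz--Pick inequality.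
  The count of solutions comes from where the recursion ends. Every step is a bijection of solution
  sets, and Schur complements preserve semidefiniteness and invertibility. If all pivots met are
  positive, no node remains and the whole class is left, which is infinite; a zero pivot of a
  semidefinite matrix makes it singular and leaves exactly one function.\<close>

lemma upper_half_plane_iff [simp]: "z \<in> upper_half_plane \<longleftrightarrow> Im z > 0"
  by (simp add: upper_half_plane_def)

lemma open_upper_half_plane: "open upper_half_plane"
  unfolding upper_half_plane_def by (rule open_halfspace_Im_gt)

lemma i_in_upper_half_plane: "\<i> \<in> upper_half_plane"
  by simp

lemma nevanlinna_iff:
  "f \<in> nevanlinna \<longleftrightarrow> f \<in> extensional upper_half_plane \<and> f holomorphic_on upper_half_plane \<and>
     (\<forall>z. Im z > 0 \<longrightarrow> Im (f z) \<ge> 0)"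
  unfolding nevanlinna_def by (auto simp: analytic_on_open open_upper_half_plane)

lemma restrict_in_nevanlinna:
  assumes "f holomorphic_on upper_half_plane" "\<And>z. Im z > 0 \<Longrightarrow> Im (f z) \<ge> 0"
  shows "restrict f upper_half_plane \<in> nevanlinna"
proof -
  have "restrict f upper_half_plane holomorphic_on upper_half_plane"
    using assms(1) by (rule holomorphic_transform) auto
  then show ?thesis
    using assms(2) by (auto simp: nevanlinna_iff)
qed

lemma norm_diff_cnj_sq:
  "(cmod (a - cnj b))\<^sup>2 = (cmod (a - b))\<^sup>2 + 4 * Im a * Im b"
  unfolding cmod_power2 by (simp add: power2_eq_square algebra_simps)

lemma cayley_less_one:
  assumes "Im a > 0" "Im b > 0"
  shows "cmod ((a - b) / (a - cnj b)) < 1"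
proof -
  have "(cmod (a - b))\<^sup>2 < (cmod (a - cnj b))\<^sup>2"
    using assms by (simp add: norm_diff_cnj_sq)
  then have "cmod (a - b) < cmod (a - cnj b)"
    by (rule power_less_imp_less_base) simp
  then show ?thesis
    by (simp add: norm_divide divide_simps)
qed

text \<open>This is the inverse of z -> (z - w) / (z - cnj w). Up to the positive factor |1 -
  \<zeta>|^2, the imaginary part is Im w (1 - |\<zeta>|^2).\<close>

lemma Im_inverse_cayley_pos:
  assumes "Im w > 0" "cmod \<zeta> < 1"
  shows "Im ((w - cnj w * \<zeta>) / (1 - \<zeta>)) > 0"
proof -
  have "\<zeta> \<noteq> 1" using assms(2) by auto
  then have *: "(Re (1 - \<zeta>))\<^sup>2 + (Im (1 - \<zeta>))\<^sup>2 > 0"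
    by (simp add: complex_eq_iff sum_power2_gt_zero_iff)
  have "(cmod \<zeta>)\<^sup>2 < 1"
    using assms(2) by (simp add: power_less_one_iff abs_square_less_1)
  then have "(Re \<zeta>)\<^sup>2 + (Im \<zeta>)\<^sup>2 < 1"
    by (simp add: cmod_power2)
  then have "Im w * (1 - (Re \<zeta>)\<^sup>2 - (Im \<zeta>)\<^sup>2) > 0"
    using assms(1) by simp
  also have "Im w * (1 - (Re \<zeta>)\<^sup>2 - (Im \<zeta>)\<^sup>2) =
      Im (w - cnj w * \<zeta>) * Re (1 - \<zeta>) - Re (w - cnj w * \<zeta>) * Im (1 - \<zeta>)"
    by (simp add: power2_eq_square algebra_simps)
  finally show ?thesis
    using * by (simp add: Im_divide del: minus_complex.sel)
qed

text \<open>The Schwarz lemma applies to \<open>f\<close> between Cayley maps that send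
  \<open>w\<close> and \<open>f w\<close> to 0. After squaring, \<open>norm_diff_cnj_sq\<close>
  makes the term |f z - f w|^2 |z - w|^2 appear on both sides and cancel. The form without
  denominators survives the passage to functions with real values.\<close>

lemma schwarz_pick_strict:
  assumes hol: "f holomorphic_on upper_half_plane"
    and pos: "\<And>z. Im z > 0 \<Longrightarrow> Im (f z) > 0"
    and z: "Im z > 0" and w: "Im w > 0"
  shows "(cmod (f z - f w))\<^sup>2 * (Im z * Im w) \<le> (cmod (z - w))\<^sup>2 * (Im (f z) * Im (f w))"
proof -
  define u where "u = (\<lambda>\<zeta>. (w - cnj w * \<zeta>) / (1 - \<zeta>))"
  define g where "g = (\<lambda>\<zeta>. (f (u \<zeta>) - f w) / (f (u \<zeta>) - cnj (f w)))"
  define \<zeta> where "\<zeta> = (z - w) / (z - cnj w)"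
  have ne: "a - cnj b \<noteq> 0" if "Im a > 0" "Im b > 0" for a b
    using that by (auto simp: complex_eq_iff)
  have u_pos: "Im (u t) > 0" if "cmod t < 1" for t
    unfolding u_def using Im_inverse_cayley_pos w that by blast
  have "u holomorphic_on ball 0 1"
    unfolding u_def by (intro holomorphic_intros) auto
  moreover have "u ` ball 0 1 \<subseteq> upper_half_plane"
    using u_pos by auto
  ultimately have "(f \<circ> u) holomorphic_on ball 0 1"
    using hol holomorphic_on_compose_gen by blast
  then have fu: "(\<lambda>t. f (u t)) holomorphic_on ball 0 1"
    by (simp add: o_def)
  have g_hol: "g holomorphic_on ball 0 1"
    unfolding g_def using ne pos u_pos w by (intro holomorphic_intros fu) auto
  have g0: "g 0 = 0"
    by (simp add: g_def u_def)
  have g1: "cmod (g t) < 1" if "cmod t < 1" for t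
    unfolding g_def using cayley_less_one pos u_pos w that by blast
  have \<zeta>1: "cmod \<zeta> < 1"
    unfolding \<zeta>_def using cayley_less_one z w by blast
  have u\<zeta>: "u \<zeta> = z"
  proof -
    have a: "z - cnj w \<noteq> 0" "w - cnj w \<noteq> 0"
      using ne z w by auto
    have 1: "1 - \<zeta> = (w - cnj w) / (z - cnj w)"
      using a by (simp add: \<zeta>_def field_simps)
    have 2: "w - cnj w * \<zeta> = z * ((w - cnj w) / (z - cnj w))"
      using a by (simp add: \<zeta>_def field_simps)
    show ?thesis
      unfolding u_def 1 2 using a by simp
  qed
  have "cmod (g \<zeta>) \<le> cmod \<zeta>"
    by (rule Schwarz_Lemma(1)[OF g_hol g0 g1 \<zeta>1])
  then have "cmod (f z - f w) / cmod (f z - cnj (f w)) \<le> cmod (z - w) / cmod (z - cnj w)"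
    unfolding g_def u\<zeta> by (simp add: \<zeta>_def norm_divide)
  then have "cmod (f z - f w) * cmod (z - cnj w) \<le> cmod (z - w) * cmod (f z - cnj (f w))"
    using ne[OF z w] ne[OF pos[OF z] pos[OF w]] by (simp add: field_simps)
  then have "(cmod (f z - f w) * cmod (z - cnj w))\<^sup>2 \<le> (cmod (z - w) * cmod (f z - cnj (f w)))\<^sup>2"
    by (rule power_mono) simp
  then show ?thesis
    by (simp add: power_mult_distrib norm_diff_cnj_sq algebra_simps)
qed

text \<open>A real value of \<open>f\<close> has no Cayley transform into the open disc, so the
  strict case is applied to f + i \<epsilon> and \<epsilon> tends to 0.\<close>

lemma schwarz_pick:
  assumes f: "f \<in> nevanlinna" and z: "Im z > 0" and w: "Im w > 0"
  shows "(cmod (f z - f w))\<^sup>2 * (Im z * Im w) \<le> (cmod (z - w))\<^sup>2 * (Im (f z) * Im (f w))"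
proof (rule tendsto_lowerbound)
  let ?r = "\<lambda>\<epsilon>::real. (cmod (z - w))\<^sup>2 * ((Im (f z) + \<epsilon>) * (Im (f w) + \<epsilon>))"
  have "(?r \<longlongrightarrow> (cmod (z - w))\<^sup>2 * ((Im (f z) + 0) * (Im (f w) + 0))) (at_right 0)"
    by (intro tendsto_intros)
  then show "(?r \<longlongrightarrow> (cmod (z - w))\<^sup>2 * (Im (f z) * Im (f w))) (at_right 0)"
    by simp
  have "(cmod (f z - f w))\<^sup>2 * (Im z * Im w) \<le> ?r \<epsilon>" if "\<epsilon> > 0" for \<epsilon> :: real
  proof -
    have "(\<lambda>z. f z + \<i> * complex_of_real \<epsilon>) holomorphic_on upper_half_plane"
      using f by (intro holomorphic_intros) (auto simp: nevanlinna_iff)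
    moreover have "Im (f t + \<i> * complex_of_real \<epsilon>) > 0" if "Im t > 0" for t
      using f that \<open>\<epsilon> > 0\<close> by (simp add: nevanlinna_iff add_nonneg_pos)
    ultimately show ?thesis
      using schwarz_pick_strict[of "\<lambda>z. f z + \<i> * complex_of_real \<epsilon>" z w] z w by simp
  qed
  then show "\<forall>\<^sub>F \<epsilon> in at_right 0. (cmod (f z - f w))\<^sup>2 * (Im z * Im w) \<le> ?r \<epsilon>"
    by (auto simp: eventually_at_right_less eventually_at_filter intro: always_eventually)
qed simp

text \<open>Takes the place of the maximum principle: a real value makes the right side of
  Schwarz--Pick vanish.\<close>

lemma nevanlinna_real_value_const:
  assumes f: "f \<in> nevanlinna" and w: "Im w > 0" "Im (f w) = 0" and z: "Im z > 0"
  shows "f z = f w"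
proof -
  have "(cmod (f z - f w))\<^sup>2 * (Im z * Im w) \<le> 0"
    using schwarz_pick[OF f z w(1)] w(2) by simp
  then have "(cmod (f z - f w))\<^sup>2 \<le> 0"
    using z w(1) by (simp add: mult_le_0_iff)
  then show ?thesis by simp
qed

subsection \<open>Nontangential limits\<close>

lemma stolz_angle_Im: "z \<in> stolz_angle x M \<Longrightarrow> Im z > 0"
  by (simp add: stolz_angle_def)

lemma stolz_angle_norm_le:
  assumes "z \<in> stolz_angle x M"
  shows "cmod (z - complex_of_real x) \<le> (1 + M) * Im z"
proof -
  have "cmod (z - complex_of_real x) \<le> \<bar>Re z - x\<bar> + \<bar>Im z\<bar>"
    using cmod_le[of "z - complex_of_real x"] by simp
  also have "\<dots> \<le> (1 + M) * Im z"
    using assms by (simp add: stolz_angle_def algebra_simps)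
  finally show ?thesis .
qed

lemma vertical_in_stolz_angle: "M \<ge> 0 \<Longrightarrow> t > 0 \<Longrightarrow> Complex x t \<in> stolz_angle x M"
  by (simp add: stolz_angle_def)

lemma stolz_angle_limit_point:
  assumes "M \<ge> 0"
  shows "at (complex_of_real x) within stolz_angle x M \<noteq> bot"
proof -
  have "\<exists>z\<in>stolz_angle x M. z \<noteq> complex_of_real x \<and> dist z (complex_of_real x) < e" if "e > 0" for e
  proof (rule bexI[of _ "Complex x (e/2)"])
    have "Complex x (e/2) - complex_of_real x = \<i> * complex_of_real (e/2)"
      by (simp add: complex_eq_iff)
    then have "dist (Complex x (e/2)) (complex_of_real x) = e/2"
      using that by (simp only: dist_norm norm_mult norm_of_real) simp
    then show "Complex x (e/2) \<noteq> complex_of_real x \<and> dist (Complex x (e/2)) (complex_of_real x) < e"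
      using that by (auto simp: complex_eq_iff)
  qed (use assms that in \<open>auto intro: vertical_in_stolz_angle\<close>)
  then have "complex_of_real x islimpt stolz_angle x M"
    by (auto simp: islimpt_approachable)
  then show ?thesis
    by (simp add: trivial_limit_within)
qed

lemma has_nt_limit_unique:
  assumes "has_nt_limit f x (Some a)" "has_nt_limit f x (Some b)"
  shows "a = b"
proof -
  have "(f \<longlongrightarrow> a) (at (complex_of_real x) within stolz_angle x 1)"
    "(f \<longlongrightarrow> b) (at (complex_of_real x) within stolz_angle x 1)"
    using assms by auto
  then show ?thesis
    by (rule tendsto_unique[OF stolz_angle_limit_point, rotated]) simp
qed

lemma has_nt_limit_not_infinite:
  assumes "has_nt_limit f x (Some a)" shows "\<not> has_nt_limit f x None"
proof
  assume "has_nt_limit f x None"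
  then have "filterlim f at_infinity (at (complex_of_real x) within stolz_angle x 1)"
    by auto
  moreover have "(f \<longlongrightarrow> a) (at (complex_of_real x) within stolz_angle x 1)"
    using assms by auto
  ultimately show False
    using not_tendsto_and_filterlim_at_infinity[OF stolz_angle_limit_point[of 1 x]] by simp
qed

lemma has_nt_limit_iff:
  "has_nt_limit f x (Some L) \<longleftrightarrow> (\<forall>M>0. \<forall>\<epsilon>>0. \<exists>\<delta>>0. \<forall>z\<in>stolz_angle x M.
     cmod (z - complex_of_real x) < \<delta> \<longrightarrow> cmod (f z - L) < \<epsilon>)"
proof -
  have "z \<noteq> complex_of_real x" if "z \<in> stolz_angle x M" for z M
    using stolz_angle_Im[OF that] by auto
  then show ?thesis
    unfolding has_nt_limit.simps Lim_within dist_norm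
    by (intro all_cong imp_cong refl ex_cong conj_cong ball_cong) auto
qed

text \<open>Members of the class are \<open>undefined\<close> off the half plane, so only agreement
  inside it can be asked for; every angle lies inside it.\<close>

lemma has_nt_limit_cong:
  assumes "\<And>z. Im z > 0 \<Longrightarrow> f z = g z"
  shows "has_nt_limit f x v \<longleftrightarrow> has_nt_limit g x v"
proof -
  have *: "\<forall>\<^sub>F z in at (complex_of_real x) within stolz_angle x M. f z = g z" for M
    using assms by (auto simp: eventually_at_filter stolz_angle_Im)
  show ?thesis
    by (cases v) (simp_all add: tendsto_cong[OF *] filterlim_cong[OF refl refl *])
qed

lemma has_nt_limit_transform:
  assumes "has_nt_limit f x v" "\<And>z. Im z > 0 \<Longrightarrow> f z = g z"
  shows "has_nt_limit g x v"
  using assms(1) has_nt_limit_cong[OF assms(2)] by simp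

subsection \<open>Boundary residues\<close>

text \<open>
  Comparing the points near \<open>x\<close> with one fixed \<open>w\<close> that nearly attains the infimum \<open>\<mu>\<close>,
  the Schwarz--Pick inequality shows that \<open>f + \<mu> / (z - x)\<close> has residue \<open>0\<close>.
\<close>
lemma nevanlinna_residue_zero:
  assumes f: "f \<in> nevanlinna"
    and inf: "\<And>\<epsilon>. \<epsilon> > 0 \<Longrightarrow> \<exists>w. Im w > 0 \<and> Im (f w) * (cmod (w - complex_of_real x))\<^sup>2 < \<epsilon> * Im w"
  shows "has_nt_limit (\<lambda>z. (z - complex_of_real x) * f z) x (Some 0)"
  unfolding has_nt_limit_iff
proof (intro allI impI)
  fix M \<epsilon> :: real assume M: "M > 0" and \<epsilon>: "\<epsilon> > 0"
  let ?x = "complex_of_real x"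
  \<comment> \<open>The factor \<open>1 + M\<close> comes from |z - x| \<le> (1 + M) Im z; the
    choice bounds the main term 2 (1 + M) K z by \<open>\<epsilon> / 4\<close>, while the constant
    terms stay below \<open>\<epsilon> / 2\<close>.\<close>
  define \<epsilon>' where "\<epsilon>' = \<epsilon> / (8 * (1 + M))"
  have "\<epsilon>' > 0" using M \<epsilon> by (simp add: \<epsilon>'_def)
  then obtain w where w: "Im w > 0" and fw: "Im (f w) * (cmod (w - ?x))\<^sup>2 < \<epsilon>' * Im w"
    using inf by blast
  define b where "b = Im (f w)"
  have b: "b \<ge> 0" using f w by (simp add: b_def nevanlinna_iff)
  \<comment> \<open>\<open>K\<close> is the Schwarz--Pick bound at \<open>w\<close> without the
    factors depending on \<open>f z\<close> and \<open>Im z\<close>; at the boundary point it equals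
    the quotient that \<open>w\<close> makes smaller than \<epsilon>'.\<close>
  define K where "K = (\<lambda>z. (cmod (z - w))\<^sup>2 * b / Im w)"
  have "(K \<longlongrightarrow> (cmod (?x - w))\<^sup>2 * b / Im w) (at ?x)"
    unfolding K_def using w by (intro tendsto_intros) auto
  moreover have "(cmod (?x - w))\<^sup>2 * b / Im w < \<epsilon>'"
    using fw w by (simp add: b_def norm_minus_commute field_simps)
  ultimately have "\<forall>\<^sub>F z in at ?x. K z < \<epsilon>'"
    by (rule order_tendstoD(2))
  then obtain \<delta>1 where \<delta>1: "\<delta>1 > 0" "\<And>z. z \<noteq> ?x \<Longrightarrow> cmod (z - ?x) < \<delta>1 \<Longrightarrow> K z < \<epsilon>'"
    by (auto simp: eventually_at dist_norm)
  define \<delta> where "\<delta> = min \<delta>1 (\<epsilon> / (2 * (1 + b + cmod (f w))))"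
  have pos: "1 + b + cmod (f w) > 0"
    using b by (intro add_pos_nonneg) auto
  show "\<exists>\<delta>>0. \<forall>z\<in>stolz_angle x M. cmod (z - ?x) < \<delta> \<longrightarrow> cmod ((z - ?x) * f z - 0) < \<epsilon>"
  proof (intro exI conjI ballI impI)
    show "\<delta> > 0" using \<delta>1 \<epsilon> pos by (simp add: \<delta>_def)
    fix z assume z: "z \<in> stolz_angle x M" and zd: "cmod (z - ?x) < \<delta>"
    have Imz: "Im z > 0" using z by (rule stolz_angle_Im)
    then have "z \<noteq> ?x" by auto
    then have Kz: "K z < \<epsilon>'" using \<delta>1 zd by (simp add: \<delta>_def)
    define D where "D = cmod (f z - f w)"
    define k where "k = K z / Im z"
    have k: "k \<ge> 0" using b w Imz by (simp add: k_def K_def)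
    have "Im (f z) \<le> D + b"
      using abs_Im_le_cmod[of "f z - f w"] by (simp add: D_def b_def)
    have "D\<^sup>2 * (Im z * Im w) \<le> (cmod (z - w))\<^sup>2 * (Im (f z) * b)"
      using schwarz_pick[OF f Imz w] by (simp add: D_def b_def)
    also have "\<dots> \<le> (cmod (z - w))\<^sup>2 * ((D + b) * b)"
      using \<open>Im (f z) \<le> D + b\<close> b by (intro mult_left_mono mult_right_mono) auto
    finally have D2: "D\<^sup>2 \<le> k * (D + b)"
      using Imz w by (simp add: k_def K_def field_simps)
    \<comment> \<open>The quadratic inequality for \<open>D\<close> bounds \<open>D\<close> linearly
      in \<open>k\<close>: otherwise \<open>b < D\<close> and k (D + b) \<le> 2 k D < D^2.\<close>
    have "D \<le> 2 * k + b"
    proof (rule ccontr)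
      assume n: "\<not> D \<le> 2 * k + b"
      then have "k * (D + b) \<le> k * (2 * D)"
        using k by (intro mult_left_mono) auto
      also have "\<dots> = (2 * k) * D" by simp
      also have "\<dots> < D * D"
        using n k b by (intro mult_strict_right_mono) auto
      finally show False using D2 by (simp add: power2_eq_square)
    qed
    moreover have "cmod (f z) \<le> D + cmod (f w)"
      unfolding D_def using norm_triangle_ineq[of "f z - f w" "f w"] by simp
    ultimately have fz: "cmod (f z) \<le> 2 * k + (1 + b + cmod (f w))" by simp
    have "cmod (z - ?x) * (2 * k) \<le> (1 + M) * Im z * (2 * k)"
      using stolz_angle_norm_le[OF z] k by (intro mult_right_mono) auto
    also have "\<dots> = 2 * (1 + M) * K z"
      using Imz by (simp add: k_def)
    also have "\<dots> < 2 * (1 + M) * \<epsilon>'"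
      using Kz M by simp
    also have "\<dots> = \<epsilon> / 4"
      using M unfolding \<epsilon>'_def by (simp add: divide_simps)
    finally have 1: "cmod (z - ?x) * (2 * k) < \<epsilon> / 4" .
    have "cmod (z - ?x) < \<epsilon> / (2 * (1 + b + cmod (f w)))"
      using zd by (simp add: \<delta>_def)
    then have 2: "cmod (z - ?x) * (1 + b + cmod (f w)) < \<epsilon> / 2"
      using pos by (simp add: field_simps)
    have "cmod (z - ?x) * cmod (f z) \<le> cmod (z - ?x) * (2 * k + (1 + b + cmod (f w)))"
      using fz by (rule mult_left_mono) simp
    also have "\<dots> < \<epsilon>"
      using 1 2 \<epsilon> by (simp add: distrib_left)
    finally show "cmod ((z - ?x) * f z - 0) < \<epsilon>"
      by (simp add: norm_mult)
  qed
qed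

lemma Im_real_over_diff:
  "Im (complex_of_real \<mu> / (z - complex_of_real x)) = - \<mu> * Im z / (cmod (z - complex_of_real x))\<^sup>2"
  by (simp add: Im_divide cmod_power2)

text \<open>Multiplying the imaginary part of the sum by |z - x|^2 gives the difference of the two
  sides of the inequality. So a Julia bound at a node with infinite value is literally membership of
  a function in the class, which is what allows that node to be removed.\<close>

lemma nevanlinna_add_pole_iff:
  "restrict (\<lambda>z. f z + complex_of_real \<mu> / (z - complex_of_real x)) upper_half_plane \<in> nevanlinna \<longleftrightarrow>
     f holomorphic_on upper_half_plane \<and>
     (\<forall>z. Im z > 0 \<longrightarrow> \<mu> * Im z \<le> Im (f z) * (cmod (z - complex_of_real x))\<^sup>2)"
  (is "?l \<longleftrightarrow> ?h \<and> ?r")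
proof -
  let ?g = "\<lambda>z. f z + complex_of_real \<mu> / (z - complex_of_real x)"
  have ne: "z \<noteq> complex_of_real x" if "Im z > 0" for z
    using that by auto
  have Im: "Im (?g z) \<ge> 0 \<longleftrightarrow> \<mu> * Im z \<le> Im (f z) * (cmod (z - complex_of_real x))\<^sup>2"
    if "Im z > 0" for z
    unfolding plus_complex.sel Im_real_over_diff using ne[OF that] by (simp add: field_simps)
  have pole: "(\<lambda>z. complex_of_real \<mu> / (z - complex_of_real x)) holomorphic_on upper_half_plane"
    using ne by (intro holomorphic_intros) auto
  show ?thesis
  proof
    assume l: ?l
    have "?g holomorphic_on upper_half_plane"
      using l by (auto simp: nevanlinna_iff intro: holomorphic_transform)
    then have "(\<lambda>z. ?g z - complex_of_real \<mu> / (z - complex_of_real x)) holomorphic_on upper_half_plane"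
      using pole by (rule holomorphic_on_diff)
    then have ?h by simp
    moreover have ?r
      using l by (auto simp: nevanlinna_iff Im simp del: plus_complex.sel)
    ultimately show "?h \<and> ?r" ..
  next
    assume "?h \<and> ?r"
    then show ?l
      using Im pole by (intro restrict_in_nevanlinna holomorphic_on_add) auto
  qed
qed

text \<open>The infimum of Im (f z) |z - x|^2 / Im z is the largest \<mu> for which f + \<mu> / (z -
  x) stays in the class. The remainder has infimum 0, hence residue 0, so the pole carries the whole
  residue. Maximality is kept in the conclusion because a Julia bound at an infinite value is a
  lower bound of this kind.\<close>

lemma nevanlinna_residue_exists:
  assumes f: "f \<in> nevanlinna"
  obtains \<mu> :: real where "\<mu> \<ge> 0"
    "\<And>z. Im z > 0 \<Longrightarrow> \<mu> * Im z \<le> Im (f z) * (cmod (z - complex_of_real x))\<^sup>2"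
    "has_nt_limit (\<lambda>z. (z - complex_of_real x) * f z) x (Some (complex_of_real (- \<mu>)))"
    "\<And>\<mu>'. (\<And>z. Im z > 0 \<Longrightarrow> \<mu>' * Im z \<le> Im (f z) * (cmod (z - complex_of_real x))\<^sup>2) \<Longrightarrow> \<mu>' \<le> \<mu>"
proof -
  let ?x = "complex_of_real x"
  define q where "q = (\<lambda>z. Im (f z) * (cmod (z - ?x))\<^sup>2 / Im z)"
  define \<mu> where "\<mu> = Inf (q ` upper_half_plane)"
  define g where "g = restrict (\<lambda>z. f z + complex_of_real \<mu> / (z - ?x)) upper_half_plane"
  have q0: "q z \<ge> 0" if "Im z > 0" for z
    using f that by (simp add: q_def nevanlinna_iff)
  have ne: "q ` upper_half_plane \<noteq> {}"
    using i_in_upper_half_plane by blast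
  have bdd: "bdd_below (q ` upper_half_plane)"
    using q0 by (intro bdd_belowI[of _ 0]) auto
  have \<mu>0: "\<mu> \<ge> 0"
    unfolding \<mu>_def using ne q0 by (intro cInf_greatest) auto
  have lower: "\<mu> * Im z \<le> Im (f z) * (cmod (z - ?x))\<^sup>2" if "Im z > 0" for z
  proof -
    have "\<mu> \<le> q z"
      unfolding \<mu>_def using bdd that by (intro cInf_lower) auto
    then show ?thesis using that by (simp add: q_def field_simps)
  qed
  have greatest: "\<mu>' \<le> \<mu>" if "\<And>z. Im z > 0 \<Longrightarrow> \<mu>' * Im z \<le> Im (f z) * (cmod (z - ?x))\<^sup>2" for \<mu>'
    unfolding \<mu>_def using ne that by (intro cInf_greatest) (auto simp: q_def pos_le_divide_eq)
  have g: "g \<in> nevanlinna"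
    unfolding g_def nevanlinna_add_pole_iff using f lower by (auto simp: nevanlinna_iff)
  have "has_nt_limit (\<lambda>z. (z - ?x) * g z) x (Some 0)"
  proof (rule nevanlinna_residue_zero[OF g])
    fix \<epsilon> :: real assume "\<epsilon> > 0"
    then obtain w where w: "Im w > 0" "q w < \<mu> + \<epsilon>"
      using cInf_lessD[OF ne, of "\<mu> + \<epsilon>"] by (auto simp: \<mu>_def)
    have "w \<noteq> ?x" using w by auto
    then have "Im (g w) * (cmod (w - ?x))\<^sup>2 = Im (f w) * (cmod (w - ?x))\<^sup>2 - \<mu> * Im w"
      using w by (simp add: g_def Im_real_over_diff) (simp add: left_diff_distrib)
    also have "\<dots> < \<epsilon> * Im w"
      using w by (simp add: q_def field_simps)
    finally show "\<exists>w. Im w > 0 \<and> Im (g w) * (cmod (w - ?x))\<^sup>2 < \<epsilon> * Im w"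
      using w by blast
  qed
  moreover have "(z - ?x) * g z = (z - ?x) * f z - complex_of_real (- \<mu>)" if "Im z > 0" for z
    using that by (auto simp: g_def distrib_left)
  ultimately have "has_nt_limit (\<lambda>z. (z - ?x) * f z - complex_of_real (- \<mu>)) x (Some 0)"
    by (rule has_nt_limit_cong[THEN iffD1, rotated])
  then have "has_nt_limit (\<lambda>z. (z - ?x) * f z) x (Some (complex_of_real (- \<mu>)))"
    by (simp only: has_nt_limit.simps LIM_zero_iff)
  with \<mu>0 lower show ?thesis
    using greatest by (rule that)
qed

subsection \<open>Boundary values and derivatives\<close>

text \<open>Needed for the mean value inequality on truncated angles.\<close>

lemma convex_stolz_angle: "convex (stolz_angle x M)"
proof -
  have "stolz_angle x M =
      {z. Im z > 0} \<inter> {z. inner (Complex 1 (-M)) z \<le> x} \<inter> {z. inner (Complex 1 M) z \<ge> x}"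
    by (auto simp: stolz_angle_def inner_complex_def)
  then show ?thesis
    by (auto intro!: convex_Int convex_halfspace_Im_gt convex_halfspace_le convex_halfspace_ge)
qed

lemma has_nt_limit_add:
  assumes "has_nt_limit f x (Some a)" "has_nt_limit g x (Some b)"
  shows "has_nt_limit (\<lambda>z. f z + g z) x (Some (a + b))"
  using assms by (auto intro: tendsto_add)

lemma has_nt_limit_minus:
  assumes "has_nt_limit f x (Some a)"
  shows "has_nt_limit (\<lambda>z. - f z) x (Some (- a))"
  using assms by (auto intro: tendsto_minus)

lemma has_nt_limit_add_iff:
  assumes "has_nt_limit g x (Some b)"
  shows "has_nt_limit (\<lambda>z. f z + g z) x (Some a) \<longleftrightarrow> has_nt_limit f x (Some (a - b))"
proof
  assume "has_nt_limit (\<lambda>z. f z + g z) x (Some a)"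
  moreover have "has_nt_limit (\<lambda>z. - g z) x (Some (- b))"
    using assms by (rule has_nt_limit_minus)
  ultimately have "has_nt_limit (\<lambda>z. (f z + g z) + - g z) x (Some (a + - b))"
    by (rule has_nt_limit_add)
  then show "has_nt_limit f x (Some (a - b))" by simp
next
  assume "has_nt_limit f x (Some (a - b))"
  from has_nt_limit_add[OF this assms] show "has_nt_limit (\<lambda>z. f z + g z) x (Some a)" by simp
qed

lemma has_nt_limit_mult:
  assumes "has_nt_limit f x (Some a)" "has_nt_limit g x (Some b)"
  shows "has_nt_limit (\<lambda>z. f z * g z) x (Some (a * b))"
  using assms by (auto intro: tendsto_mult)

lemma has_nt_limit_inverse:
  assumes "has_nt_limit f x (Some a)" "a \<noteq> 0"
  shows "has_nt_limit (\<lambda>z. inverse (f z)) x (Some (inverse a))"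
  using assms by (auto intro: tendsto_inverse)

lemma has_nt_limit_continuous:
  assumes "isCont f (complex_of_real x)"
  shows "has_nt_limit f x (Some (f (complex_of_real x)))"
  using assms by (auto simp: isCont_def intro: tendsto_within_subset)

text \<open>Makes the separate requirement of an infinite boundary value automatic once the residue
  is known to be nonzero.\<close>

lemma nonzero_residue_imp_infinite:
  assumes "has_nt_limit (\<lambda>z. (z - of_real x) * f z) x (Some r)" "r \<noteq> 0"
  shows "has_nt_limit f x None"
proof -
  have "filterlim f at_infinity (at (complex_of_real x) within stolz_angle x M)" if "M > 0" for M
  proof -
    let ?F = "at (complex_of_real x) within stolz_angle x M"
    have "((\<lambda>z. z - complex_of_real x) \<longlongrightarrow> complex_of_real x - complex_of_real x) ?F"
      by (intro tendsto_intros)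
    then have "filterlim (\<lambda>z. z - complex_of_real x) (at 0) ?F"
      by (auto simp: filterlim_at eventually_at_filter)
    then have "filterlim (\<lambda>z. inverse (z - complex_of_real x)) at_infinity ?F"
      by (rule filterlim_compose[OF filterlim_inverse_at_infinity])
    moreover have "((\<lambda>z. (z - of_real x) * f z) \<longlongrightarrow> r) ?F"
      using assms(1) that by auto
    ultimately have "filterlim (\<lambda>z. ((z - of_real x) * f z) * inverse (z - complex_of_real x)) at_infinity ?F"
      using assms(2) by (intro tendsto_mult_filterlim_at_infinity)
    moreover have "\<forall>\<^sub>F z in ?F. ((z - of_real x) * f z) * inverse (z - complex_of_real x) = f z"
      by (auto simp: eventually_at_filter)
    ultimately show ?thesis
      by (rule filterlim_cong[OF refl refl, THEN iffD1, rotated])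
  qed
  then show ?thesis by simp
qed

lemma nt_quotient_limit_imp_value:
  assumes "has_nt_limit (\<lambda>z. (f z - \<eta>) / (z - complex_of_real x)) x (Some d)"
  shows "has_nt_limit f x (Some \<eta>)"
proof -
  let ?x = "complex_of_real x"
  have "has_nt_limit (\<lambda>z. (z - ?x) * ((f z - \<eta>) / (z - ?x)) + \<eta>) x (Some ((?x - ?x) * d + \<eta>))"
    by (intro has_nt_limit_add has_nt_limit_mult has_nt_limit_continuous assms) auto
  moreover have "(z - ?x) * ((f z - \<eta>) / (z - ?x)) + \<eta> = f z" if "Im z > 0" for z
    using that by auto
  ultimately have "has_nt_limit f x (Some ((?x - ?x) * d + \<eta>))"
    by (rule has_nt_limit_cong[THEN iffD1, rotated])
  then show ?thesis by simp
qed

text \<open>Cauchy's estimate for f(z) - \<eta> - d (z - x), which is o(|z - x|) in each angle. The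
  discs of radius Im z / 2 leave the given angle, so the hypothesis is used in a wider one.\<close>

lemma nt_quotient_limit_imp_deriv:
  assumes hol: "f holomorphic_on upper_half_plane"
    and lim: "has_nt_limit (\<lambda>z. (f z - \<eta>) / (z - complex_of_real x)) x (Some d)"
  shows "has_nt_limit (deriv f) x (Some d)"
  unfolding has_nt_limit_iff
proof (intro allI impI)
  fix M \<epsilon> :: real assume M: "M > 0" and \<epsilon>: "\<epsilon> > 0"
  let ?x = "complex_of_real x"
  \<comment> \<open>Cauchy's estimate yields 3 \<epsilon>' |z - x| / Im z, at most 3 (1 + M)
    \<epsilon>' in the angle, that is 3/4 of \<epsilon>.\<close>
  define \<epsilon>' where "\<epsilon>' = \<epsilon> / (4 * (1 + M))"
  have \<epsilon>': "\<epsilon>' > 0" "2 * M + 1 > 0" using M \<epsilon> by (auto simp: \<epsilon>'_def)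
  then obtain \<delta> where \<delta>: "\<delta> > 0" "\<And>z. z \<in> stolz_angle x (2 * M + 1) \<Longrightarrow> cmod (z - ?x) < \<delta> \<Longrightarrow>
      cmod ((f z - \<eta>) / (z - ?x) - d) < \<epsilon>'"
    using lim[unfolded has_nt_limit_iff, rule_format, of "2 * M + 1" \<epsilon>'] by auto
  define h where "h = (\<lambda>z. f z - \<eta> - d * (z - ?x))"
  have h_hol: "h holomorphic_on upper_half_plane"
    unfolding h_def by (intro holomorphic_intros hol)
  have h_le: "cmod (h z) \<le> \<epsilon>' * cmod (z - ?x)"
    if z: "z \<in> stolz_angle x (2 * M + 1)" "cmod (z - ?x) < \<delta>" for z
  proof -
    have "z \<noteq> ?x" using stolz_angle_Im[OF z(1)] by auto
    then have "h z = ((f z - \<eta>) / (z - ?x) - d) * (z - ?x)"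
      unfolding h_def left_diff_distrib by simp
    then show ?thesis
      using \<delta>(2)[OF z] by (simp add: norm_mult mult_right_mono)
  qed
  show "\<exists>\<delta>>0. \<forall>z\<in>stolz_angle x M. cmod (z - ?x) < \<delta> \<longrightarrow> cmod (deriv f z - d) < \<epsilon>"
  proof (intro exI conjI ballI impI)
    show "\<delta> / 2 > 0" using \<delta> by simp
    fix z assume z: "z \<in> stolz_angle x M" and zd: "cmod (z - ?x) < \<delta> / 2"
    have Imz: "Im z > 0" using z by (rule stolz_angle_Im)
    let ?r = "Im z / 2"
    have Imz_le: "Im z \<le> cmod (z - ?x)"
      using abs_Im_le_cmod[of "z - ?x"] by simp
    \<comment> \<open>On the disc Im w \<ge> Im z / 2, so the horizontal distance (2 M + 1) Im z / 2
      is at most (2 M + 1) Im w: this is the aperture chosen above. The factor 3/2 explains why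
      \<open>\<delta> / 2\<close> suffices.\<close>
    have in_stolz: "w \<in> stolz_angle x (2 * M + 1)" "cmod (w - ?x) \<le> 3/2 * cmod (z - ?x)"
      if "cmod (z - w) \<le> ?r" for w
    proof -
      have re: "\<bar>Re w - Re z\<bar> \<le> ?r" and im: "\<bar>Im w - Im z\<bar> \<le> ?r"
        using abs_Re_le_cmod[of "w - z"] abs_Im_le_cmod[of "w - z"] that
        by (auto simp: norm_minus_commute)
      have Imw: "Im w > 0" using im Imz by linarith
      have "\<bar>Re w - x\<bar> \<le> M * Im z + Im z / 2"
        using re z unfolding stolz_angle_def mem_Collect_eq by linarith
      also have "\<dots> = (2 * M + 1) * ?r" by (simp add: algebra_simps)
      also have "\<dots> \<le> (2 * M + 1) * Im w"
        using im M by (intro mult_left_mono; linarith)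
      finally show "w \<in> stolz_angle x (2 * M + 1)"
        using Imw by (simp add: stolz_angle_def)
      have "cmod (w - ?x) \<le> cmod (w - z) + cmod (z - ?x)"
        using norm_triangle_ineq[of "w - z" "z - ?x"] by simp
      then show "cmod (w - ?x) \<le> 3/2 * cmod (z - ?x)"
        using that Imz_le by (simp add: norm_minus_commute)
    qed
    have sub: "cball z ?r \<subseteq> upper_half_plane"
      using in_stolz(1) stolz_angle_Im by (force simp: dist_norm)
    have "cmod ((deriv ^^ 1) h z) \<le> fact 1 * (\<epsilon>' * (3/2 * cmod (z - ?x))) / ?r ^ 1"
    proof (rule Cauchy_inequality)
      show "h holomorphic_on ball z ?r"
        using h_hol sub ball_subset_cball holomorphic_on_subset by blast
      show "continuous_on (cball z ?r) h"
        using h_hol sub holomorphic_on_imp_continuous_on holomorphic_on_subset by blast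
      show "?r > 0" using Imz by simp
      fix w assume w: "cmod (z - w) = ?r"
      have "cmod (w - ?x) < \<delta>"
        using in_stolz(2)[of w] w zd \<delta>(1) by auto
      then have "cmod (h w) \<le> \<epsilon>' * cmod (w - ?x)"
        using in_stolz(1)[of w] w h_le by auto
      also have "\<dots> \<le> \<epsilon>' * (3/2 * cmod (z - ?x))"
        using in_stolz(2)[of w] w \<epsilon>' by (intro mult_left_mono) auto
      finally show "cmod (h w) \<le> \<epsilon>' * (3/2 * cmod (z - ?x))" .
    qed
    also have "\<dots> = 3 * \<epsilon>' * cmod (z - ?x) / Im z" using Imz by simp
    also have "\<dots> \<le> 3 * \<epsilon>' * ((1 + M) * Im z) / Im z"
      using stolz_angle_norm_le[OF z] \<epsilon>' Imz by (intro divide_right_mono mult_left_mono) auto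
    also have "\<dots> = 3 / 4 * \<epsilon>"
      using Imz M unfolding \<epsilon>'_def by (simp add: divide_simps)
    also have "\<dots> < \<epsilon>" using \<epsilon> by simp
    finally have "cmod (deriv h z) < \<epsilon>" by simp
    moreover have "deriv h z = deriv f z - d"
    proof (rule DERIV_imp_deriv)
      have "f field_differentiable at z"
        using hol Imz by (intro holomorphic_on_imp_differentiable_at[OF _ open_upper_half_plane]) auto
      then have "(f has_field_derivative deriv f z) (at z)"
        by (rule field_differentiable_derivI)
      then show "(h has_field_derivative deriv f z - d) (at z)"
        unfolding h_def by (auto intro!: derivative_eq_intros)
    qed
    ultimately show "cmod (deriv f z - d) < \<epsilon>" by simp
  qed
qed

text \<open>On a small truncated angle f(z) - d z is Lipschitz with constant
  \<open>\<epsilon> / 2\<close>, by convexity; letting the second point tend to the vertex replaces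
  it by the boundary value \<eta>.\<close>

lemma nt_deriv_limit_imp_quotient:
  assumes hol: "f holomorphic_on upper_half_plane"
    and val: "has_nt_limit f x (Some \<eta>)"
    and der: "has_nt_limit (deriv f) x (Some d)"
  shows "has_nt_limit (\<lambda>z. (f z - \<eta>) / (z - complex_of_real x)) x (Some d)"
  unfolding has_nt_limit_iff
proof (intro allI impI)
  fix M \<epsilon> :: real assume M: "M > 0" and \<epsilon>: "\<epsilon> > 0"
  let ?x = "complex_of_real x"
  obtain \<delta> where \<delta>: "\<delta> > 0" "\<And>z. z \<in> stolz_angle x M \<Longrightarrow> cmod (z - ?x) < \<delta> \<Longrightarrow>
      cmod (deriv f z - d) < \<epsilon> / 2"
    using der[unfolded has_nt_limit_iff, rule_format, of M "\<epsilon> / 2"] \<epsilon> M by auto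
  show "\<exists>\<delta>>0. \<forall>z\<in>stolz_angle x M. cmod (z - ?x) < \<delta> \<longrightarrow> cmod ((f z - \<eta>) / (z - ?x) - d) < \<epsilon>"
  proof (intro exI conjI ballI impI)
    show "\<delta> > 0" using \<delta> by simp
    fix z assume z: "z \<in> stolz_angle x M" and zd: "cmod (z - ?x) < \<delta>"
    define S where "S = stolz_angle x M \<inter> ball ?x \<delta>"
    define h where "h = (\<lambda>z. f z - d * z)"
    have zS: "z \<in> S" using z zd by (simp add: S_def dist_norm norm_minus_commute)
    have lip: "cmod (h z - h w) \<le> \<epsilon> / 2 * cmod (z - w)" if "w \<in> S" for w
    proof (rule field_differentiable_bound[of S h "\<lambda>z. deriv f z - d"])
      show "convex S" by (simp add: S_def convex_Int convex_stolz_angle)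
      fix t assume t: "t \<in> S"
      then have "Im t > 0" using stolz_angle_Im by (auto simp: S_def)
      then have "f field_differentiable at t"
        using hol by (intro holomorphic_on_imp_differentiable_at[OF _ open_upper_half_plane]) auto
      then have "(f has_field_derivative deriv f t) (at t within S)"
        using field_differentiable_derivI has_field_derivative_at_within by blast
      then show "(h has_field_derivative deriv f t - d) (at t within S)"
        unfolding h_def by (auto intro!: derivative_eq_intros)
      show "cmod (deriv f t - d) \<le> \<epsilon> / 2"
        using \<delta>(2)[of t] t by (auto simp: S_def dist_norm norm_minus_commute)
    qed (use zS that in auto)
    have h_le: "cmod (h z - (\<eta> - d * ?x)) \<le> \<epsilon> / 2 * cmod (z - ?x)"
    proof (rule tendsto_le)
      let ?F = "at ?x within stolz_angle x M"
      show "?F \<noteq> bot" using M by (simp add: stolz_angle_limit_point)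
      have "(f \<longlongrightarrow> \<eta>) ?F" using val M by auto
      then show "((\<lambda>w. cmod (h z - h w)) \<longlongrightarrow> cmod (h z - (\<eta> - d * ?x))) ?F"
        unfolding h_def by (intro tendsto_intros)
      show "((\<lambda>w. \<epsilon> / 2 * cmod (z - w)) \<longlongrightarrow> \<epsilon> / 2 * cmod (z - ?x)) ?F"
        by (intro tendsto_intros)
      show "\<forall>\<^sub>F w in ?F. cmod (h z - h w) \<le> \<epsilon> / 2 * cmod (z - w)"
        unfolding eventually_at using \<delta>(1) lip
        by (intro exI[of _ \<delta>]) (auto simp: S_def dist_commute)
    qed
    have zx: "z \<noteq> ?x" using stolz_angle_Im[OF z] by auto
    then have quot: "(f z - \<eta>) / (z - ?x) * (z - ?x) = f z - \<eta>" by simp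
    have "h z - (\<eta> - d * ?x) = ((f z - \<eta>) / (z - ?x) - d) * (z - ?x)"
      unfolding h_def left_diff_distrib[of _ d] quot by (simp add: right_diff_distrib)
    with h_le zx have "cmod ((f z - \<eta>) / (z - ?x) - d) \<le> \<epsilon> / 2"
      by (simp add: norm_mult)
    then show "cmod ((f z - \<eta>) / (z - ?x) - d) < \<epsilon>" using \<epsilon> by simp
  qed
qed

subsection \<open>The Julia--Caratheodory bound\<close>

text \<open>For \<infinity> this is the homogeneous form of the inequality: writing \<phi> = a / b
  with b = 0 leaves e^2 Im z \<le> 0. The sign of \<open>g\<close> is required explicitly because
  the inequality holds for every \<open>g\<close> when \<open>f\<close> is the constant
  \<open>c / e\<close>.\<close>

definition julia_bound :: "(complex \<Rightarrow> complex) option \<Rightarrow> real \<Rightarrow> real \<Rightarrow> real \<Rightarrow> real \<Rightarrow> bool" where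
  "julia_bound \<phi> x c e g \<longleftrightarrow> (case \<phi> of
     None \<Rightarrow> e = 0 \<and> g \<ge> 0
   | Some f \<Rightarrow> g \<ge> 0 \<and> (\<forall>z. Im z > 0 \<longrightarrow>
       (cmod (of_real e * f z - of_real c))\<^sup>2 * Im z \<le> g * Im (f z) * (cmod (z - of_real x))\<^sup>2))"

definition ext_add :: "(complex \<Rightarrow> complex) \<Rightarrow> (complex \<Rightarrow> complex) option \<Rightarrow> (complex \<Rightarrow> complex) option" where
  "ext_add h = map_option (\<lambda>f. restrict (\<lambda>z. f z + h z) upper_half_plane)"

text \<open>Testing the single point \<open>\<i>\<close> is enough: a member of the class with one
  zero vanishes identically. The zero function and \<infinity> are exchanged.\<close>

definition ext_neg_inv :: "(complex \<Rightarrow> complex) option \<Rightarrow> (complex \<Rightarrow> complex) option" where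
  "ext_neg_inv \<phi> = (case \<phi> of
     None \<Rightarrow> Some (restrict (\<lambda>_. 0) upper_half_plane)
   | Some f \<Rightarrow> if f \<i> = 0 then None else Some (restrict (\<lambda>z. - 1 / f z) upper_half_plane))"

section \<open>Real Moebius maps on the extended class\<close>

lemma None_in_ext_nevanlinna [simp]: "None \<in> ext_nevanlinna"
  and Some_in_ext_nevanlinna [simp]: "Some f \<in> ext_nevanlinna \<longleftrightarrow> f \<in> nevanlinna"
  by (auto simp: ext_nevanlinna_def)

lemma ext_add_simps [simp]:
  "ext_add h None = None"
  "ext_add h (Some f) = Some (restrict (\<lambda>z. f z + h z) upper_half_plane)"
  by (simp_all add: ext_add_def)

lemma nevanlinna_zero_iff:
  assumes f: "f \<in> nevanlinna" and w: "Im w > 0"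
  shows "f w = 0 \<longleftrightarrow> f = restrict (\<lambda>_. 0) upper_half_plane"
proof
  assume "f w = 0"
  then have "f z = 0" if "Im z > 0" for z
    using nevanlinna_real_value_const[OF f w _ that] by simp
  then show "f = restrict (\<lambda>_. 0) upper_half_plane"
    using f by (intro extensionalityI[of _ upper_half_plane]) (auto simp: nevanlinna_iff)
qed (use w in simp)

lemma nevanlinna_nonzero:
  assumes f: "f \<in> nevanlinna" and "f \<i> \<noteq> 0" and w: "Im w > 0"
  shows "f w \<noteq> 0"
  using nevanlinna_zero_iff[OF f w] nevanlinna_zero_iff[OF f, of \<i>] assms(2) by simp

lemma Im_neg_inverse: "Im (- 1 / a) = Im a / (cmod a)\<^sup>2"
  by (simp add: Im_divide cmod_power2)

lemma ext_neg_inv_closed: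
  assumes "\<phi> \<in> ext_nevanlinna" shows "ext_neg_inv \<phi> \<in> ext_nevanlinna"
proof (cases \<phi>)
  case None
  then show ?thesis by (auto simp: ext_neg_inv_def intro!: restrict_in_nevanlinna)
next
  case (Some f)
  then have f: "f \<in> nevanlinna" using assms by simp
  show ?thesis
  proof (cases "f \<i> = 0")
    case False
    have "restrict (\<lambda>z. - 1 / f z) upper_half_plane \<in> nevanlinna"
    proof (rule restrict_in_nevanlinna)
      show "(\<lambda>z. - 1 / f z) holomorphic_on upper_half_plane"
        using f nevanlinna_nonzero[OF f False]
        by (intro holomorphic_intros) (auto simp: nevanlinna_iff)
      show "Im (- 1 / f z) \<ge> 0" if "Im z > 0" for z
        unfolding Im_neg_inverse using f that by (simp add: nevanlinna_iff)
    qed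
    then show ?thesis using Some False by (simp add: ext_neg_inv_def)
  qed (simp add: Some ext_neg_inv_def)
qed

lemma ext_neg_inv_involution:
  assumes "\<phi> \<in> ext_nevanlinna" shows "ext_neg_inv (ext_neg_inv \<phi>) = \<phi>"
proof (cases \<phi>)
  case (Some f)
  then have f: "f \<in> nevanlinna" using assms by simp
  show ?thesis
  proof (cases "f \<i> = 0")
    case True
    then show ?thesis
      using Some nevanlinna_zero_iff[OF f, of \<i>] by (simp add: ext_neg_inv_def)
  next
    case False
    have "restrict (\<lambda>z. - 1 / restrict (\<lambda>z. - 1 / f z) upper_half_plane z) upper_half_plane = f"
      using f nevanlinna_nonzero[OF f False]
      by (intro extensionalityI[of _ upper_half_plane]) (auto simp: nevanlinna_iff)
    then show ?thesis using Some False by (simp add: ext_neg_inv_def)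
  qed
qed (simp add: ext_neg_inv_def)

lemma all_upper_half_plane_mult_le_0_iff:
  "(\<forall>z. Im z > 0 \<longrightarrow> a * Im z \<le> 0) \<longleftrightarrow> a \<le> 0"
proof
  assume "\<forall>z. Im z > 0 \<longrightarrow> a * Im z \<le> 0"
  from this[rule_format, of \<i>] show "a \<le> 0" by simp
qed (simp add: mult_nonpos_nonneg)

text \<open>Both sides of the inequality pick up the factor 1 / |f|^2, so \<open>g\<close> is
  unchanged, and the value \<open>c / e\<close> becomes -e / c.\<close>

lemma julia_bound_ext_neg_inv:
  assumes "\<phi> \<in> ext_nevanlinna"
  shows "julia_bound (ext_neg_inv \<phi>) x (- e) c g \<longleftrightarrow> julia_bound \<phi> x c e g"
proof (cases \<phi>)
  case None
  have "(\<forall>z. Im z > 0 \<longrightarrow> e\<^sup>2 * Im z \<le> 0) \<longleftrightarrow> e = 0"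
    by (simp add: all_upper_half_plane_mult_le_0_iff)
  then show ?thesis
    using None by (auto simp: ext_neg_inv_def julia_bound_def cong: imp_cong)
next
  case (Some f)
  then have f: "f \<in> nevanlinna" using assms by simp
  show ?thesis
  proof (cases "f \<i> = 0")
    case True
    then have "f = restrict (\<lambda>_. 0) upper_half_plane"
      using nevanlinna_zero_iff[OF f, of \<i>] by simp
    moreover have "(\<forall>z. Im z > 0 \<longrightarrow> c\<^sup>2 * Im z \<le> 0) \<longleftrightarrow> c = 0"
      by (simp add: all_upper_half_plane_mult_le_0_iff)
    ultimately show ?thesis
      using Some True by (auto simp: ext_neg_inv_def julia_bound_def cong: imp_cong)
  next
    case False
    have "(cmod (of_real c * (- 1 / f z) - of_real (- e)))\<^sup>2 * Im z \<le> g * Im (- 1 / f z) * (cmod (z - of_real x))\<^sup>2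
      \<longleftrightarrow> (cmod (of_real e * f z - of_real c))\<^sup>2 * Im z \<le> g * Im (f z) * (cmod (z - of_real x))\<^sup>2"
      if "Im z > 0" for z
    proof -
      have nz: "f z \<noteq> 0" using nevanlinna_nonzero[OF f False that] .
      have "of_real c * (- 1 / f z) - of_real (- e) = (of_real e * f z - of_real c) / f z"
        using nz by (simp add: field_simps)
      then have "(cmod (of_real c * (- 1 / f z) - of_real (- e)))\<^sup>2 =
          (cmod (of_real e * f z - of_real c))\<^sup>2 / (cmod (f z))\<^sup>2"
        by (simp only: norm_divide power_divide)
      moreover have "a / (cmod (f z))\<^sup>2 * Im z \<le> g * (Im (f z) / (cmod (f z))\<^sup>2) * b \<longleftrightarrow>
          a * Im z \<le> g * Im (f z) * b" for a b
        using nz by (simp add: divide_simps)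
      ultimately show ?thesis
        unfolding Im_neg_inverse by simp
    qed
    then show ?thesis
      using Some False by (simp add: ext_neg_inv_def julia_bound_def cong: imp_cong)
  qed
qed

lemma ext_add_closed:
  assumes "\<phi> \<in> ext_nevanlinna" "h holomorphic_on upper_half_plane" "\<And>z. Im z > 0 \<Longrightarrow> Im (h z) \<ge> 0"
  shows "ext_add h \<phi> \<in> ext_nevanlinna"
proof (cases \<phi>)
  case (Some f)
  then have "f holomorphic_on upper_half_plane" "\<And>z. Im z > 0 \<Longrightarrow> Im (f z) \<ge> 0"
    using assms(1) by (auto simp: nevanlinna_iff)
  then have "restrict (\<lambda>z. f z + h z) upper_half_plane \<in> nevanlinna"
    using assms(2,3) by (intro restrict_in_nevanlinna holomorphic_on_add) auto
  then show ?thesis using Some by simp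
qed simp

lemma ext_add_inverse:
  assumes "\<phi> \<in> ext_nevanlinna" "\<And>z. Im z > 0 \<Longrightarrow> h' z = - h z"
  shows "ext_add h' (ext_add h \<phi>) = \<phi>"
proof (cases \<phi>)
  case (Some f)
  have "restrict (\<lambda>z. restrict (\<lambda>z. f z + h z) upper_half_plane z + h' z) upper_half_plane = f"
    using assms Some by (intro extensionalityI[of _ upper_half_plane]) (auto simp: nevanlinna_iff)
  then show ?thesis using Some by simp
qed simp

lemma julia_bound_translate:
  "julia_bound (ext_add (\<lambda>_. of_real a) \<phi>) x (c + a * e) e g \<longleftrightarrow> julia_bound \<phi> x c e g"
  by (cases \<phi>) (auto simp: julia_bound_def algebra_simps cong: imp_cong)

section \<open>The bound in terms of nontangential limits\<close>

text \<open>With \<open>e = 0\<close> the inequality says that c^2 / g is a lower bound of the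
  quotient whose infimum is the negative of the residue.\<close>

lemma julia_bound_pole_iff:
  assumes f: "f \<in> nevanlinna" and c: "c \<noteq> 0"
  shows "julia_bound (Some f) x c 0 g \<longleftrightarrow>
    (\<exists>r::real. has_nt_limit (\<lambda>z. (z - of_real x) * f z) x (Some (of_real r)) \<and> c\<^sup>2 \<le> - r * g)"
  (is "_ \<longleftrightarrow> ?r")
proof -
  obtain \<mu> :: real where \<mu>: "\<mu> \<ge> 0"
      "\<And>z. Im z > 0 \<Longrightarrow> \<mu> * Im z \<le> Im (f z) * (cmod (z - of_real x))\<^sup>2"
      "has_nt_limit (\<lambda>z. (z - of_real x) * f z) x (Some (of_real (- \<mu>)))"
      "\<And>\<mu>'. (\<And>z. Im z > 0 \<Longrightarrow> \<mu>' * Im z \<le> Im (f z) * (cmod (z - of_real x))\<^sup>2) \<Longrightarrow> \<mu>' \<le> \<mu>"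
    by (rule nevanlinna_residue_exists[OF f, where x = x]) blast
  have c2: "c\<^sup>2 > 0" using c by simp
  have jb: "julia_bound (Some f) x c 0 g \<longleftrightarrow>
      g \<ge> 0 \<and> (\<forall>z. Im z > 0 \<longrightarrow> c\<^sup>2 * Im z \<le> g * Im (f z) * (cmod (z - of_real x))\<^sup>2)"
    by (simp add: julia_bound_def)
  have "?r \<longleftrightarrow> c\<^sup>2 \<le> \<mu> * g"
  proof
    assume ?r
    then obtain r :: real where r: "has_nt_limit (\<lambda>z. (z - of_real x) * f z) x (Some (of_real r))"
        "c\<^sup>2 \<le> - r * g" by blast
    have "r = - \<mu>"
      using has_nt_limit_unique[OF r(1) \<mu>(3)] by (simp only: of_real_eq_iff)
    then show "c\<^sup>2 \<le> \<mu> * g" using r(2) by simp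
  next
    assume "c\<^sup>2 \<le> \<mu> * g"
    then show ?r using \<mu>(3) by (intro exI[of _ "- \<mu>"]) simp
  qed
  also have "\<dots> \<longleftrightarrow> julia_bound (Some f) x c 0 g"
  proof
    assume l: "c\<^sup>2 \<le> \<mu> * g"
    then have "\<mu> * g > 0" using c2 by linarith
    then have g: "g > 0" using \<mu>(1) by (simp add: zero_less_mult_iff)
    have "c\<^sup>2 * Im z \<le> g * Im (f z) * (cmod (z - of_real x))\<^sup>2" if z: "Im z > 0" for z
    proof -
      have "c\<^sup>2 * Im z \<le> g * (\<mu> * Im z)"
        using mult_right_mono[OF l, of "Im z"] z by (simp add: mult_ac)
      also have "\<dots> \<le> g * (Im (f z) * (cmod (z - of_real x))\<^sup>2)"
        using \<mu>(2)[OF z] g by (intro mult_left_mono) auto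
      finally show ?thesis by (simp add: mult_ac)
    qed
    then show "julia_bound (Some f) x c 0 g" unfolding jb using g by simp
  next
    assume j: "julia_bound (Some f) x c 0 g"
    \<comment> \<open>One point of the half plane shows that \<open>g = 0\<close> would force
      \<open>c = 0\<close>.\<close>
    then have *: "c\<^sup>2 \<le> g * Im (f \<i>) * (cmod (\<i> - of_real x))\<^sup>2" and "g \<ge> 0"
      unfolding jb by (auto dest: spec[of _ \<i>])
    then have g: "g > 0" using c2 by (cases "g = 0") auto
    have "c\<^sup>2 / g \<le> \<mu>"
      using j g unfolding jb by (intro \<mu>(4)) (auto simp: field_simps)
    then show "c\<^sup>2 \<le> \<mu> * g" using g by (simp add: field_simps)
  qed
  finally show ?thesis by simp
qed

text \<open>
  Here \<open>- 1 / (f - c / e)\<close> has residue \<open>- 1 / d\<close>, so the Julia--Caratheodory theorem for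
  \<open>f\<close> is the existence of residues for this function.
\<close>
lemma julia_bound_finite_iff:
  assumes f: "f \<in> nevanlinna" and e: "e \<noteq> 0"
  shows "julia_bound (Some f) x c e g \<longleftrightarrow>
    (\<exists>d::real. has_nt_limit (\<lambda>z. (f z - of_real (c / e)) / (z - of_real x)) x (Some (of_real d)) \<and>
       d * e\<^sup>2 \<le> g)"
  (is "_ \<longleftrightarrow> (\<exists>d. ?q d \<and> _)")
proof -
  define f' where "f' = restrict (\<lambda>z. f z + of_real (- (c / e))) upper_half_plane"
  have "julia_bound (Some f) x c e g \<longleftrightarrow>
      julia_bound (ext_add (\<lambda>_. of_real (- (c / e))) (Some f)) x (c + - (c / e) * e) e g"
    by (simp only: julia_bound_translate)
  then have j: "julia_bound (Some f) x c e g \<longleftrightarrow> julia_bound (Some f') x 0 e g"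
    using e by (simp add: f'_def)
  have f': "f' \<in> nevanlinna"
    using ext_add_closed[of "Some f" "\<lambda>_. of_real (- (c / e))"] f by (simp add: f'_def)
  show ?thesis
  proof (cases "f' \<i> = 0")
    \<comment> \<open>The constant \<open>c / e\<close> has no finite reciprocal after translation;
      here both sides reduce to \<open>g \<ge> 0\<close>.\<close>
    case True
    then have "f' = restrict (\<lambda>_. 0) upper_half_plane"
      using nevanlinna_zero_iff[OF f', of \<i>] by simp
    then have f'0: "f' z = 0" if "Im z > 0" for z
      using that by simp
    then have "(f z - of_real (c / e)) / (z - of_real x) = 0" if "Im z > 0" for z
      using that by (simp add: f'_def)
    then have "?q d \<longleftrightarrow> has_nt_limit (\<lambda>_. 0) x (Some (of_real d))" for d
      by (intro has_nt_limit_cong)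
    moreover have "has_nt_limit (\<lambda>_. 0) x (Some (of_real d)) \<longleftrightarrow> d = 0" for d
      using has_nt_limit_unique[of "\<lambda>_. 0" x "of_real d" 0] by auto
    ultimately show ?thesis
      unfolding j using f'0 by (simp add: julia_bound_def)
  next
    case False
    define p where "p = restrict (\<lambda>z. - 1 / f' z) upper_half_plane"
    have p: "p \<in> nevanlinna"
      using ext_neg_inv_closed[of "Some f'"] f' False by (simp add: ext_neg_inv_def p_def)
    have "julia_bound (Some f') x 0 e g \<longleftrightarrow> julia_bound (Some p) x (- e) 0 g"
      using julia_bound_ext_neg_inv[of "Some f'" x e 0 g] f' False by (simp add: ext_neg_inv_def p_def)
    also have "\<dots> \<longleftrightarrow> (\<exists>r::real. has_nt_limit (\<lambda>z. (z - of_real x) * p z) x (Some (of_real r)) \<and> e\<^sup>2 \<le> - r * g)"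
      using julia_bound_pole_iff[OF p, of "- e"] e by simp
    also have "\<dots> \<longleftrightarrow> (\<exists>d. ?q d \<and> d * e\<^sup>2 \<le> g)"
    proof -
      obtain \<mu> :: real where \<mu>: "\<mu> \<ge> 0" "has_nt_limit (\<lambda>z. (z - of_real x) * p z) x (Some (of_real (- \<mu>)))"
        by (rule nevanlinna_residue_exists[OF p, where x = x]) blast
      have r: "has_nt_limit (\<lambda>z. (z - of_real x) * p z) x (Some (of_real r)) \<longleftrightarrow> r = - \<mu>" for r :: real
        using has_nt_limit_unique[OF _ \<mu>(2), of "of_real r"] \<mu>(2) by (auto simp only: of_real_eq_iff)
      have quot: "(f z - of_real (c / e)) / (z - of_real x) = inverse (- ((z - of_real x) * p z))"
        and prod: "(f z - of_real (c / e)) / (z - of_real x) * ((z - of_real x) * p z) = - 1"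
        if z: "Im z > 0" for z
      proof -
        have "f' z \<noteq> 0" "z \<noteq> of_real x"
          using nevanlinna_nonzero[OF f' False z] z by auto
        moreover have eqs: "f z - of_real (c / e) = f' z" "p z = - 1 / f' z"
          using z by (auto simp: f'_def p_def)
        ultimately show "(f z - of_real (c / e)) / (z - of_real x) = inverse (- ((z - of_real x) * p z))"
          "(f z - of_real (c / e)) / (z - of_real x) * ((z - of_real x) * p z) = - 1"
          unfolding eqs by simp_all
      qed
      \<comment> \<open>The product of quotient and residue expression is identically -1. Hence
        \<mu> = 0 excludes a finite limit of the quotient, and otherwise the limit is
        \<open>1 / \<mu>\<close>.\<close>
      have q: "?q d \<longleftrightarrow> \<mu> \<noteq> 0 \<and> d = 1 / \<mu>" for d
      proof
        assume "?q d"
        then have "has_nt_limit (\<lambda>z. (f z - of_real (c / e)) / (z - of_real x) * ((z - of_real x) * p z)) x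
            (Some (of_real d * of_real (- \<mu>)))"
          using \<mu>(2) by (rule has_nt_limit_mult)
        then have "has_nt_limit (\<lambda>_. - 1) x (Some (of_real d * of_real (- \<mu>)))"
          by (rule has_nt_limit_transform) (rule prod)
        then have "has_nt_limit (\<lambda>_. - 1) x (Some (of_real (d * - \<mu>)))"
          by (simp only: of_real_mult)
        then have "of_real (d * - \<mu>) = (of_real (- 1) :: complex)"
          by (rule has_nt_limit_unique) simp
        then have "d * - \<mu> = - 1" by (simp only: of_real_eq_iff)
        then have "d * \<mu> = 1" by simp
        then show "\<mu> \<noteq> 0 \<and> d = 1 / \<mu>" by (cases "\<mu> = 0") (auto simp: nonzero_eq_divide_eq)
      next
        assume d: "\<mu> \<noteq> 0 \<and> d = 1 / \<mu>"
        have "has_nt_limit (\<lambda>z. - ((z - of_real x) * p z)) x (Some (of_real \<mu>))"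
          using has_nt_limit_minus[OF \<mu>(2)] by simp
        then have "has_nt_limit (\<lambda>z. inverse (- ((z - of_real x) * p z))) x (Some (inverse (of_real \<mu>)))"
          by (rule has_nt_limit_inverse) (use d in simp)
        then have "has_nt_limit (\<lambda>z. (f z - of_real (c / e)) / (z - of_real x)) x (Some (inverse (of_real \<mu>)))"
          by (rule has_nt_limit_transform) (rule quot[symmetric])
        moreover have "inverse (of_real \<mu>) = (of_real d :: complex)"
          using d by (simp add: inverse_eq_divide)
        ultimately show "?q d" by (simp only:)
      qed
      show ?thesis
      proof (cases "\<mu> = 0")
        case True
        then show ?thesis unfolding q r using e by simp
      next
        case False
        then have "1 / \<mu> * e\<^sup>2 \<le> g \<longleftrightarrow> e\<^sup>2 \<le> \<mu> * g"
          using \<mu>(1) by (simp add: pos_divide_le_eq mult.commute)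
        then show ?thesis unfolding q r using False by simp
      qed
    qed
    finally show ?thesis using j by simp
  qed
qed

text \<open>The limit \<open>d\<close> is itself an admissible bound \<open>g\<close> for
  \<open>e = 1\<close>, and the bound includes the sign of \<open>g\<close>.\<close>

lemma nt_quotient_nonneg:
  assumes "f \<in> nevanlinna"
    and "has_nt_limit (\<lambda>z. (f z - of_real \<eta>) / (z - of_real x)) x (Some (of_real d))"
  shows "d \<ge> 0"
proof -
  have "julia_bound (Some f) x \<eta> 1 d"
    using assms by (subst julia_bound_finite_iff) auto
  then show ?thesis by (simp add: julia_bound_def)
qed

text \<open>The inequality is not additive in \<phi>, so the proof passes to limits. The added term
  h is regular at \<open>x\<close>: it leaves the residue alone when \<open>e = 0\<close>, and
  otherwise shifts the value by h(x) = \<kappa> / (x - y) and the derivative by h'(x) = -\<kappa> /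
  (x - y)^2, scaled by e^2 in \<open>g\<close>.\<close>

lemma julia_bound_add_pole:
  fixes x y \<kappa> :: real
  defines "h \<equiv> \<lambda>z. of_real \<kappa> / (z - of_real y)"
  assumes \<phi>: "\<phi> \<in> ext_nevanlinna" and \<psi>: "ext_add h \<phi> \<in> ext_nevanlinna"
    and xy: "x \<noteq> y" and ce: "c \<noteq> 0 \<or> e \<noteq> 0"
  shows "julia_bound (ext_add h \<phi>) x (c + e * \<kappa> / (x - y)) e (g - e\<^sup>2 * \<kappa> / (x - y)\<^sup>2) \<longleftrightarrow> julia_bound \<phi> x c e g"
proof (cases \<phi>)
  case None
  then show ?thesis by (auto simp: julia_bound_def)
next
  case (Some f)
  define f1 where "f1 = restrict (\<lambda>z. f z + h z) upper_half_plane"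
  have f: "f \<in> nevanlinna" and f1: "f1 \<in> nevanlinna" and \<psi>_eq: "ext_add h \<phi> = Some f1"
    using \<phi> \<psi> Some by (auto simp: f1_def)
  have cxy: "complex_of_real x - complex_of_real y \<noteq> 0"
    using xy by simp
  show ?thesis
  proof (cases "e = 0")
    case True
    with ce have c: "c \<noteq> 0" by simp
    have "has_nt_limit (\<lambda>z. (z - of_real x) * h z) x (Some ((of_real x - of_real x) * h (of_real x)))"
      unfolding h_def using cxy by (intro has_nt_limit_continuous continuous_intros) auto
    then have h0: "has_nt_limit (\<lambda>z. (z - of_real x) * h z) x (Some 0)" by simp
    have "has_nt_limit (\<lambda>z. (z - of_real x) * f1 z) x (Some r) \<longleftrightarrow>
        has_nt_limit (\<lambda>z. (z - of_real x) * f z + (z - of_real x) * h z) x (Some r)" for r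
      by (rule has_nt_limit_cong) (simp add: f1_def distrib_left)
    then have "has_nt_limit (\<lambda>z. (z - of_real x) * f1 z) x (Some r) \<longleftrightarrow>
        has_nt_limit (\<lambda>z. (z - of_real x) * f z) x (Some r)" for r
      using has_nt_limit_add_iff[OF h0] by simp
    then show ?thesis
      unfolding \<psi>_eq unfolding Some using True
      by (simp add: julia_bound_pole_iff[OF f c] julia_bound_pole_iff[OF f1 c] del: has_nt_limit.simps)
  next
    case False
    define \<eta> where "\<eta> = c / e"
    define \<delta> where "\<delta> = \<kappa> / (x - y)\<^sup>2"
    have \<eta>1: "(c + e * \<kappa> / (x - y)) / e = \<eta> + \<kappa> / (x - y)"
      using False by (simp add: \<eta>_def add_divide_distrib)
    have "has_nt_limit (\<lambda>z. - (of_real \<kappa> / ((z - of_real y) * (of_real x - of_real y)))) x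
        (Some (- (of_real \<kappa> / ((of_real x - of_real y) * (of_real x - of_real y)))))"
      using cxy by (intro has_nt_limit_continuous continuous_intros) auto
    then have h1: "has_nt_limit (\<lambda>z. - (of_real \<kappa> / ((z - of_real y) * (of_real x - of_real y)))) x
        (Some (of_real (- \<delta>)))"
      by (simp add: \<delta>_def power2_eq_square)
    have quot: "(f1 z - of_real (\<eta> + \<kappa> / (x - y))) / (z - of_real x) =
        (f z - of_real \<eta>) / (z - of_real x) + - (of_real \<kappa> / ((z - of_real y) * (of_real x - of_real y)))"
      if z: "Im z > 0" for z
    proof -
      have ne: "z - of_real x \<noteq> 0" "z - of_real y \<noteq> 0" using z by auto
      have "h z - of_real (\<kappa> / (x - y)) =
          (z - of_real x) * - (of_real \<kappa> / ((z - of_real y) * (of_real x - of_real y)))"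
        using ne cxy by (simp add: h_def divide_simps) (simp add: algebra_simps)
      moreover have "f1 z - of_real (\<eta> + \<kappa> / (x - y)) = (f z - of_real \<eta>) + (h z - of_real (\<kappa> / (x - y)))"
        using z by (simp add: f1_def)
      ultimately show ?thesis
        using ne(1) by (simp only: add_divide_distrib nonzero_mult_div_cancel_left[OF ne(1)])
    qed
    have "has_nt_limit (\<lambda>z. (f1 z - of_real (\<eta> + \<kappa> / (x - y))) / (z - of_real x)) x (Some (of_real d)) \<longleftrightarrow>
        has_nt_limit (\<lambda>z. (f z - of_real \<eta>) / (z - of_real x)) x (Some (of_real d - of_real (- \<delta>)))" for d
      unfolding has_nt_limit_add_iff[OF h1, symmetric] by (rule has_nt_limit_cong) (rule quot)
    then have lim: "has_nt_limit (\<lambda>z. (f1 z - of_real (\<eta> + \<kappa> / (x - y))) / (z - of_real x)) x (Some (of_real d)) \<longleftrightarrow>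
        has_nt_limit (\<lambda>z. (f z - of_real \<eta>) / (z - of_real x)) x (Some (of_real (d + \<delta>)))" for d
      by simp
    have "julia_bound (Some f1) x (c + e * \<kappa> / (x - y)) e (g - e\<^sup>2 * \<kappa> / (x - y)\<^sup>2) \<longleftrightarrow>
        (\<exists>d. has_nt_limit (\<lambda>z. (f z - of_real \<eta>) / (z - of_real x)) x (Some (of_real (d + \<delta>))) \<and>
           d * e\<^sup>2 \<le> g - e\<^sup>2 * \<kappa> / (x - y)\<^sup>2)"
      unfolding julia_bound_finite_iff[OF f1 False] \<eta>1 lim ..
    also have "\<dots> \<longleftrightarrow> (\<exists>d. has_nt_limit (\<lambda>z. (f z - of_real \<eta>) / (z - of_real x)) x (Some (of_real (d + \<delta>))) \<and>
           (d + \<delta>) * e\<^sup>2 \<le> g)"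
      by (simp add: \<delta>_def algebra_simps)
    also have "\<dots> \<longleftrightarrow> (\<exists>d. has_nt_limit (\<lambda>z. (f z - of_real \<eta>) / (z - of_real x)) x (Some (of_real d)) \<and>
           d * e\<^sup>2 \<le> g)"
      (is "(\<exists>d. ?P d) \<longleftrightarrow> (\<exists>d. ?Q d)")
    proof
      assume "\<exists>d. ?Q d"
      then obtain d where "?Q d" ..
      then have "?P (d - \<delta>)" by (simp only: diff_add_cancel)
      then show "\<exists>d. ?P d" ..
    qed blast
    also have "\<dots> \<longleftrightarrow> julia_bound \<phi> x c e g"
      unfolding Some julia_bound_finite_iff[OF f False] \<eta>_def ..
    finally show ?thesis unfolding \<psi>_eq .
  qed
qed

text \<open>The strict case, the case of equality with a positive bound and the degenerate case
  \<open>p = 0\<close> add up to one non-strict inequality. For a finite value, the limit of the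
  difference quotient carries value and derivative at once and supplies the lower bound 0.\<close>

lemma cond_C46_iff_julia_bound:
  assumes \<phi>: "\<phi> \<in> ext_nevanlinna" and ce: "c \<noteq> 0 \<or> e \<noteq> 0"
  shows "cond_C46 x p c e \<phi> \<longleftrightarrow> julia_bound \<phi> x c e (- p)"
proof (cases "e = 0")
  case False
  have "cond_C46 x p c e \<phi> \<longleftrightarrow> has_boundary_value \<phi> x (Some (of_real (c / e))) \<and>
      (\<exists>d::real. has_boundary_deriv \<phi> x (Some (of_real d)) \<and> 0 \<le> d \<and> d \<le> - p / e\<^sup>2)"
    (is "?l \<longleftrightarrow> ?r")
  proof
    assume ?l
    then have "cond_C4 x p c e \<phi> \<or> cond_C5 x p c e \<phi> \<or> cond_C6 x p c e \<phi>"
      using False by (auto simp: cond_C46_def cond_C4_tilde_def cond_C5_tilde_def cond_C6_tilde_def)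
    then show ?r
    proof (elim disjE)
      assume "cond_C4 x p c e \<phi>"
      then show ?r unfolding cond_C4_def by (auto intro: less_imp_le)
    next
      assume "cond_C5 x p c e \<phi>"
      then show ?r unfolding cond_C5_def by (intro conjI exI[of _ "- p / e\<^sup>2"]) auto
    next
      assume "cond_C6 x p c e \<phi>"
      then show ?r unfolding cond_C6_def by (intro conjI exI[of _ 0]) auto
    qed
  next
    assume ?r
    then obtain d :: real where d: "has_boundary_value \<phi> x (Some (of_real (c / e)))"
        "has_boundary_deriv \<phi> x (Some (of_real d))" "0 \<le> d" "d \<le> - p / e\<^sup>2" by blast
    consider "d < - p / e\<^sup>2" | "d = - p / e\<^sup>2" "d > 0" | "d = - p / e\<^sup>2" "d = 0"
      using d by linarith
    then show ?l
    proof cases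
      case 1
      then have "cond_C4 x p c e \<phi>" unfolding cond_C4_def using d False by blast
      then show ?l by (simp add: cond_C46_def)
    next
      case 2
      then have "cond_C5 x p c e \<phi>" unfolding cond_C5_def using d False by simp
      then show ?l by (simp add: cond_C46_def)
    next
      case 3
      then have "p = 0" using False by simp
      then have "cond_C6 x p c e \<phi>" unfolding cond_C6_def using d False 3 by simp
      then show ?l by (simp add: cond_C46_def)
    qed
  qed
  also have "\<dots> \<longleftrightarrow> julia_bound \<phi> x c e (- p)"
  proof (cases \<phi>)
    case None
    then show ?thesis using False by (simp add: julia_bound_def)
  next
    case (Some f)
    then have f: "f \<in> nevanlinna" and hol: "f holomorphic_on upper_half_plane"
      using \<phi> by (auto simp: nevanlinna_iff)
    have "has_nt_limit (\<lambda>z. (f z - of_real (c / e)) / (z - of_real x)) x (Some (of_real d)) \<longleftrightarrow>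
        has_nt_limit f x (Some (of_real (c / e))) \<and> has_nt_limit (deriv f) x (Some (of_real d)) \<and> 0 \<le> d" for d
      using nt_quotient_limit_imp_value[of f "of_real (c / e)" x "of_real d"]
        nt_quotient_limit_imp_deriv[OF hol, of "of_real (c / e)" x "of_real d"]
        nt_deriv_limit_imp_quotient[OF hol, of x "of_real (c / e)" "of_real d"]
        nt_quotient_nonneg[OF f, of "c / e" x d] by blast
    moreover have "d * e\<^sup>2 \<le> - p \<longleftrightarrow> d \<le> - p / e\<^sup>2" for d
      using False pos_le_divide_eq[of "e\<^sup>2" d "- p"] by simp
    ultimately show ?thesis
      unfolding Some julia_bound_finite_iff[OF f False] by auto
  qed
  finally show ?thesis .
next
  case True
  with ce have c: "c \<noteq> 0" by simp
  have "cond_C46 x p c e \<phi> \<longleftrightarrow> has_boundary_value \<phi> x None \<and>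
      (\<exists>r. \<exists>t::real. has_boundary_residue \<phi> x r \<and> ext_recip r = Some (of_real t) \<and> 0 \<le> - t \<and> - t \<le> - p / c\<^sup>2)"
    (is "?l \<longleftrightarrow> ?r")
  proof
    assume ?l
    then have "cond_C4_tilde x p c e \<phi> \<or> cond_C5_tilde x p c e \<phi> \<or> cond_C6_tilde x p c e \<phi>"
      using True by (auto simp: cond_C46_def cond_C4_def cond_C5_def cond_C6_def)
    then show ?r
    proof (elim disjE)
      assume "cond_C4_tilde x p c e \<phi>"
      then show ?r unfolding cond_C4_tilde_def by (blast intro: less_imp_le)
    next
      assume "cond_C5_tilde x p c e \<phi>"
      then obtain r where r: "has_boundary_value \<phi> x None" "has_boundary_residue \<phi> x r"
          "ext_recip r = Some (of_real (p / c\<^sup>2))" "p / c\<^sup>2 < 0"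
        unfolding cond_C5_tilde_def by blast
      then show ?r
        by (intro conjI exI[of _ r] exI[of _ "p / c\<^sup>2"]) auto
    next
      assume "cond_C6_tilde x p c e \<phi>"
      then obtain r where r: "has_boundary_value \<phi> x None" "has_boundary_residue \<phi> x r"
          "ext_recip r = Some (of_real p)" "p = 0"
        unfolding cond_C6_tilde_def by blast
      then show ?r
        by (intro conjI exI[of _ r] exI[of _ 0]) auto
    qed
  next
    assume ?r
    then obtain r and t :: real where r: "has_boundary_value \<phi> x None" "has_boundary_residue \<phi> x r"
        "ext_recip r = Some (of_real t)" "0 \<le> - t" "- t \<le> - p / c\<^sup>2" by blast
    consider "- t < - p / c\<^sup>2" | "t = p / c\<^sup>2" "t < 0" | "t = p / c\<^sup>2" "t = 0"
      using r by fastforce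
    then show ?l
    proof cases
      case 1
      then have "cond_C4_tilde x p c e \<phi>" unfolding cond_C4_tilde_def using r True by blast
      then show ?l by (simp add: cond_C46_def)
    next
      case 2
      then have "cond_C5_tilde x p c e \<phi>" unfolding cond_C5_tilde_def using r True by blast
      then show ?l by (simp add: cond_C46_def)
    next
      case 3
      then have "p = 0" using c by simp
      then have "cond_C6_tilde x p c e \<phi>" unfolding cond_C6_tilde_def using r True 3 by auto
      then show ?l by (simp add: cond_C46_def)
    qed
  qed
  also have "\<dots> \<longleftrightarrow> julia_bound \<phi> x c e (- p)"
  proof (cases \<phi>)
    case None
    \<comment> \<open>The function \<infinity> has infinite residue, whose reciprocal is 0, so only
      the sign of \<open>p\<close> remains.\<close>
    have "(\<exists>t::real. (0::complex) = of_real t \<and> 0 \<le> - t \<and> - t \<le> - p / c\<^sup>2) \<longleftrightarrow> p \<le> 0"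
      using c by (auto simp: divide_le_0_iff field_simps)
    then show ?thesis using None True by (simp add: julia_bound_def)
  next
    case (Some f)
    then have f: "f \<in> nevanlinna" using \<phi> by simp
    obtain \<mu> :: real where \<mu>: "\<mu> \<ge> 0"
        "has_nt_limit (\<lambda>z. (z - of_real x) * f z) x (Some (of_real (- \<mu>)))"
      by (rule nevanlinna_residue_exists[OF f, where x = x]) blast
    have res: "has_nt_limit (\<lambda>z. (z - of_real x) * f z) x r \<longleftrightarrow> r = Some (of_real (- \<mu>))" for r
    proof (cases r)
      case None
      then show ?thesis
        using has_nt_limit_not_infinite[OF \<mu>(2)] by (simp del: has_nt_limit.simps)
    next
      case (Some a)
      then show ?thesis
        using has_nt_limit_unique[of "\<lambda>z. (z - of_real x) * f z" x a] \<mu>(2) by blast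
    qed
    \<comment> \<open>\<open>ext_recip\<close> sends 0 to \<infinity>, so a zero residue fails the
      condition; this agrees with the bound, which fails for \<mu> = 0 because c is nonzero.\<close>
    have recip: "ext_recip (Some (of_real (- \<mu>))) = Some (of_real t) \<longleftrightarrow> \<mu> \<noteq> 0 \<and> t = - 1 / \<mu>" for t
    proof -
      have "1 / complex_of_real (- \<mu>) = of_real (- 1 / \<mu>)" by simp
      then show ?thesis by (auto simp del: of_real_minus of_real_divide)
    qed
    have r: "(of_real r :: complex) = of_real (- \<mu>) \<longleftrightarrow> r = - \<mu>" for r
      by (rule of_real_eq_iff)
    have j: "julia_bound \<phi> x c e (- p) \<longleftrightarrow> c\<^sup>2 \<le> \<mu> * - p"
      unfolding Some True julia_bound_pole_iff[OF f c] res option.inject r by simp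
    have infinite: "has_nt_limit f x None" if "\<mu> \<noteq> 0"
      using nonzero_residue_imp_infinite[OF \<mu>(2)] that by simp
    have bound: "1 / \<mu> \<le> - p / c\<^sup>2 \<longleftrightarrow> c\<^sup>2 \<le> \<mu> * - p" if "\<mu> \<noteq> 0"
    proof -
      have "\<mu> > 0" using that \<mu>(1) by simp
      have "1 / \<mu> \<le> - p / c\<^sup>2 \<longleftrightarrow> 1 / \<mu> * c\<^sup>2 \<le> - p"
        using c by (intro pos_le_divide_eq) simp
      also have "\<dots> \<longleftrightarrow> c\<^sup>2 \<le> \<mu> * - p"
        using \<open>\<mu> > 0\<close> by (simp add: pos_divide_le_eq mult.commute)
      finally show ?thesis .
    qed
    have "(\<exists>r. \<exists>t::real. r = Some (of_real (- \<mu>)) \<and> ext_recip r = Some (of_real t) \<and> 0 \<le> - t \<and> - t \<le> - p / c\<^sup>2)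
        \<longleftrightarrow> (\<exists>t. (\<mu> \<noteq> 0 \<and> t = - 1 / \<mu>) \<and> 0 \<le> - t \<and> - t \<le> - p / c\<^sup>2)"
      unfolding recip[symmetric] by blast
    also have "\<dots> \<longleftrightarrow> \<mu> \<noteq> 0 \<and> 1 / \<mu> \<le> - p / c\<^sup>2"
    proof -
      have "0 \<le> - (- 1 / \<mu>)" "- (- 1 / \<mu>) = 1 / \<mu>" using \<mu>(1) by simp_all
      then show ?thesis by auto
    qed
    finally have "(has_boundary_value \<phi> x None \<and> (\<exists>r. \<exists>t::real. has_boundary_residue \<phi> x r \<and>
        ext_recip r = Some (of_real t) \<and> 0 \<le> - t \<and> - t \<le> - p / c\<^sup>2)) \<longleftrightarrow>
        has_nt_limit f x None \<and> \<mu> \<noteq> 0 \<and> 1 / \<mu> \<le> - p / c\<^sup>2"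
      unfolding Some has_boundary_value.simps has_boundary_residue.simps res by (simp only:)
    also have "\<dots> \<longleftrightarrow> \<mu> \<noteq> 0 \<and> c\<^sup>2 \<le> \<mu> * - p"
      using infinite bound by blast
    also have "\<dots> \<longleftrightarrow> c\<^sup>2 \<le> \<mu> * - p"
      using c by auto
    finally show ?thesis unfolding j .
  qed
  finally show ?thesis .
qed

subsection \<open>Schur complements\<close>

text \<open>Arbitrary index sets instead of matrices: deleting a node then needs no
  renumbering.\<close>

definition psd_on :: "'a set \<Rightarrow> ('a \<Rightarrow> 'a \<Rightarrow> real) \<Rightarrow> bool" where
  "psd_on I A \<longleftrightarrow> (\<forall>v. (\<Sum>i\<in>I. \<Sum>j\<in>I. A i j * v i * v j) \<ge> 0)"

definition nonsingular_on :: "'a set \<Rightarrow> ('a \<Rightarrow> 'a \<Rightarrow> real) \<Rightarrow> bool" where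
  "nonsingular_on I A \<longleftrightarrow> (\<forall>v. (\<forall>i\<in>I. (\<Sum>j\<in>I. A i j * v j) = 0) \<longrightarrow> (\<forall>i\<in>I. v i = 0))"

lemma psd_on_cong:
  assumes "\<And>i j. i \<in> I \<Longrightarrow> j \<in> I \<Longrightarrow> A i j = B i j"
  shows "psd_on I A \<longleftrightarrow> psd_on I B"
proof -
  have "(\<Sum>i\<in>I. \<Sum>j\<in>I. A i j * v i * v j) = (\<Sum>i\<in>I. \<Sum>j\<in>I. B i j * v i * v j)" for v
    by (intro sum.cong refl) (simp add: assms)
  then show ?thesis by (simp add: psd_on_def)
qed

lemma nonsingular_on_cong:
  assumes "\<And>i j. i \<in> I \<Longrightarrow> j \<in> I \<Longrightarrow> A i j = B i j"
  shows "nonsingular_on I A \<longleftrightarrow> nonsingular_on I B"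
proof -
  have "(\<Sum>j\<in>I. A i j * v j) = (\<Sum>j\<in>I. B i j * v j)" if "i \<in> I" for v i
    by (intro sum.cong refl) (simp add: assms that)
  then show ?thesis by (simp add: nonsingular_on_def)
qed

lemma quadratic_form_insert:
  fixes A :: "'a \<Rightarrow> 'a \<Rightarrow> real"
  assumes I: "finite I" "k \<notin> I" and sym: "\<And>i. i \<in> I \<Longrightarrow> A i k = A k i"
  shows "(\<Sum>i\<in>insert k I. \<Sum>j\<in>insert k I. A i j * v i * v j) =
    A k k * (v k)\<^sup>2 + 2 * v k * (\<Sum>j\<in>I. A k j * v j) + (\<Sum>i\<in>I. \<Sum>j\<in>I. A i j * v i * v j)"
proof -
  have "(\<Sum>i\<in>I. A i k * v i * v k) = v k * (\<Sum>j\<in>I. A k j * v j)"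
    "(\<Sum>j\<in>I. A k j * v k * v j) = v k * (\<Sum>j\<in>I. A k j * v j)"
    by (simp_all add: sum_distrib_left sym mult_ac)
  then show ?thesis
    using I by (simp add: sum.distrib power2_eq_square)
qed

lemma quadratic_form_schur:
  fixes A :: "'a \<Rightarrow> 'a \<Rightarrow> real"
  shows "(\<Sum>i\<in>I. \<Sum>j\<in>I. (A i j - b i * b j / a) * v i * v j) =
    (\<Sum>i\<in>I. \<Sum>j\<in>I. A i j * v i * v j) - (\<Sum>j\<in>I. b j * v j)\<^sup>2 / a"
proof -
  have "(\<Sum>j\<in>I. b j * v j)\<^sup>2 / a = (\<Sum>i\<in>I. \<Sum>j\<in>I. b i * b j / a * v i * v j)"
    unfolding power2_eq_square sum_product sum_divide_distrib
    by (intro sum.cong refl) (simp add: mult_ac)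
  then show ?thesis
    by (simp add: left_diff_distrib sum_subtractf)
qed

text \<open>Completing the square in the coordinate \<open>v k\<close> leaves the form of the Schur
  complement in the other coordinates.\<close>

lemma psd_on_schur:
  fixes A :: "'a \<Rightarrow> 'a \<Rightarrow> real"
  assumes I: "finite I" "k \<notin> I" and sym: "\<And>i. i \<in> I \<Longrightarrow> A i k = A k i" and a: "A k k > 0"
  shows "psd_on (insert k I) A \<longleftrightarrow> psd_on I (\<lambda>i j. A i j - A k i * A k j / A k k)"
proof -
  let ?B = "\<lambda>i j. A i j - A k i * A k j / A k k"
  have square: "(\<Sum>i\<in>insert k I. \<Sum>j\<in>insert k I. A i j * v i * v j) =
      A k k * (v k + (\<Sum>j\<in>I. A k j * v j) / A k k)\<^sup>2 + (\<Sum>i\<in>I. \<Sum>j\<in>I. ?B i j * v i * v j)" for v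
  proof -
    have complete_square: "a * t\<^sup>2 + 2 * t * L + s = a * (t + L / a)\<^sup>2 + (s - L\<^sup>2 / a)" if "a > 0" for a t L s :: real
      using that by (simp add: power2_eq_square field_simps)
    have "(\<Sum>i\<in>insert k I. \<Sum>j\<in>insert k I. A i j * v i * v j) =
        A k k * (v k)\<^sup>2 + 2 * v k * (\<Sum>j\<in>I. A k j * v j) + (\<Sum>i\<in>I. \<Sum>j\<in>I. A i j * v i * v j)"
      using I sym by (rule quadratic_form_insert)
    also have "\<dots> = A k k * (v k + (\<Sum>j\<in>I. A k j * v j) / A k k)\<^sup>2 + (\<Sum>i\<in>I. \<Sum>j\<in>I. ?B i j * v i * v j)"
      unfolding quadratic_form_schur using a by (rule complete_square)
    finally show ?thesis .
  qed
  show ?thesis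
  proof
    assume psd: "psd_on (insert k I) A"
    show "psd_on I ?B"
      unfolding psd_on_def
    proof
      fix v
      \<comment> \<open>This value at \<open>k\<close> annihilates the completed square.\<close>
      define u where "u = v(k := - (\<Sum>j\<in>I. A k j * v j) / A k k)"
      have u: "u i = v i" if "i \<in> I" for i
        using I(2) that by (auto simp: u_def)
      have "(\<Sum>j\<in>I. A k j * u j) = (\<Sum>j\<in>I. A k j * v j)"
        by (intro sum.cong refl) (simp add: u)
      then have "u k + (\<Sum>j\<in>I. A k j * u j) / A k k = 0"
        by (simp add: u_def)
      moreover have "(\<Sum>i\<in>insert k I. \<Sum>j\<in>insert k I. A i j * u i * u j) \<ge> 0"
        using psd by (simp only: psd_on_def)
      ultimately have "0 \<le> (\<Sum>i\<in>I. \<Sum>j\<in>I. ?B i j * u i * u j)"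
        unfolding square by simp
      also have "\<dots> = (\<Sum>i\<in>I. \<Sum>j\<in>I. ?B i j * v i * v j)"
        by (intro sum.cong refl) (simp add: u)
      finally show "0 \<le> (\<Sum>i\<in>I. \<Sum>j\<in>I. ?B i j * v i * v j)" .
    qed
  next
    assume "psd_on I ?B"
    then show "psd_on (insert k I) A"
      unfolding psd_on_def square using a by (auto intro!: add_nonneg_nonneg)
  qed
qed

text \<open>Gaussian elimination: row \<open>k\<close> determines \<open>v k\<close>, and
  substituting it turns the other rows into those of the Schur complement.\<close>

lemma nonsingular_on_schur:
  fixes A :: "'a \<Rightarrow> 'a \<Rightarrow> real"
  assumes I: "finite I" "k \<notin> I" and sym: "\<And>i. i \<in> I \<Longrightarrow> A i k = A k i" and a: "A k k > 0"
  shows "nonsingular_on (insert k I) A \<longleftrightarrow> nonsingular_on I (\<lambda>i j. A i j - A k i * A k j / A k k)"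
proof -
  let ?B = "\<lambda>i j. A i j - A k i * A k j / A k k"
  have B: "(\<Sum>j\<in>I. ?B i j * v j) = (\<Sum>j\<in>I. A i j * v j) - A k i / A k k * (\<Sum>j\<in>I. A k j * v j)" for i v
    by (simp add: left_diff_distrib sum_subtractf sum_distrib_left mult.assoc)
  have row_k: "(\<Sum>j\<in>insert k I. A k j * v j) = 0 \<longleftrightarrow> v k = - (\<Sum>j\<in>I. A k j * v j) / A k k" for v
  proof -
    have "A k k * v k + s = 0 \<longleftrightarrow> v k = - s / A k k" for s
      using a by (simp add: field_simps) linarith
    then show ?thesis using I by simp
  qed
  have row_i: "(\<Sum>j\<in>insert k I. A i j * v j) = (\<Sum>j\<in>I. ?B i j * v j)"
    if "i \<in> I" "v k = - (\<Sum>j\<in>I. A k j * v j) / A k k" for i v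
    using I that by (simp add: B sym)
  show ?thesis
  proof
    assume ns: "nonsingular_on (insert k I) A"
    show "nonsingular_on I ?B"
      unfolding nonsingular_on_def
    proof (intro allI impI)
      fix v assume v: "\<forall>i\<in>I. (\<Sum>j\<in>I. ?B i j * v j) = 0"
      define u where "u = v(k := - (\<Sum>j\<in>I. A k j * v j) / A k k)"
      have u: "u i = v i" if "i \<in> I" for i
        using I(2) that by (auto simp: u_def)
      have sum_u: "(\<Sum>j\<in>I. f j * u j) = (\<Sum>j\<in>I. f j * v j)" for f
        by (intro sum.cong refl) (simp add: u)
      have uk: "u k = - (\<Sum>j\<in>I. A k j * u j) / A k k"
        unfolding sum_u by (simp add: u_def)
      have "(\<Sum>j\<in>insert k I. A i j * u j) = 0" if "i \<in> I" for i
        unfolding row_i[OF that uk] sum_u using v that by blast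
      then have "\<forall>i\<in>insert k I. (\<Sum>j\<in>insert k I. A i j * u j) = 0"
        using row_k[of u] uk by blast
      then have "\<forall>i\<in>insert k I. u i = 0"
        by (rule ns[unfolded nonsingular_on_def, THEN spec, THEN mp])
      then show "\<forall>i\<in>I. v i = 0" using u by auto
    qed
  next
    assume ns: "nonsingular_on I ?B"
    show "nonsingular_on (insert k I) A"
      unfolding nonsingular_on_def
    proof (intro allI impI)
      fix v assume v: "\<forall>i\<in>insert k I. (\<Sum>j\<in>insert k I. A i j * v j) = 0"
      then have vk: "v k = - (\<Sum>j\<in>I. A k j * v j) / A k k"
        using row_k[of v] by blast
      have "\<forall>i\<in>I. (\<Sum>j\<in>I. ?B i j * v j) = 0"
      proof
        fix i assume i: "i \<in> I"
        show "(\<Sum>j\<in>I. ?B i j * v j) = 0"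
          unfolding row_i[OF i vk, symmetric] using v i by blast
      qed
      then have vI: "\<forall>i\<in>I. v i = 0"
        by (rule ns[unfolded nonsingular_on_def, THEN spec, THEN mp])
      then have "v k = 0" unfolding vk by simp
      with vI show "\<forall>i\<in>insert k I. v i = 0" by simp
    qed
  qed
qed

subsection \<open>The boundary Nevanlinna--Pick problem\<close>

text \<open>In use, \<open>p\<close> is semidefiniteness and \<open>q\<close> invertibility of the
  Pick matrix. Only the cardinality of \<open>S\<close> enters, so the statement moves along
  bijections of solution sets.\<close>

definition solution_trichotomy :: "'a set \<Rightarrow> bool \<Rightarrow> bool \<Rightarrow> bool" where
  "solution_trichotomy S p q \<longleftrightarrow>
     (S \<noteq> {} \<longleftrightarrow> p) \<and> (p \<longrightarrow> (q \<longrightarrow> infinite S) \<and> (\<not> q \<longrightarrow> (\<exists>!s. s \<in> S)))"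

lemma solution_trichotomy_bij_betw:
  assumes "bij_betw f S T"
  shows "solution_trichotomy S p q \<longleftrightarrow> solution_trichotomy T p q"
proof -
  have "S = {} \<longleftrightarrow> T = {}" "finite S \<longleftrightarrow> finite T"
    using assms bij_betw_finite by (auto simp: bij_betw_def)
  moreover have "card S = card T"
    using assms by (rule bij_betw_same_card)
  moreover have "(\<exists>!s. s \<in> X) \<longleftrightarrow> card X = 1" for X :: "'b set"
    by (auto simp: card_1_singleton_iff)
  moreover have "(\<exists>!s. s \<in> X) \<longleftrightarrow> card X = 1" for X :: "'a set"
    by (auto simp: card_1_singleton_iff)
  ultimately show ?thesis
    unfolding solution_trichotomy_def by metis
qed

text \<open>The Pick matrix for values \<open>c / e\<close> in homogeneous coordinates; e = 1 gives
  the usual difference quotients. The numerator is a determinant, hence invariant under rotations of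
  the pairs.\<close>

definition boundary_pick ::
  "('a \<Rightarrow> real) \<Rightarrow> ('a \<Rightarrow> real) \<Rightarrow> ('a \<Rightarrow> real) \<Rightarrow> ('a \<Rightarrow> real) \<Rightarrow> 'a \<Rightarrow> 'a \<Rightarrow> real" where
  "boundary_pick x c e g i j = (if i = j then g i else (e i * c j - c i * e j) / (x j - x i))"

definition boundary_solutions ::
  "'a set \<Rightarrow> ('a \<Rightarrow> real) \<Rightarrow> ('a \<Rightarrow> real) \<Rightarrow> ('a \<Rightarrow> real) \<Rightarrow> ('a \<Rightarrow> real) \<Rightarrow> (complex \<Rightarrow> complex) option set" where
  "boundary_solutions I x c e g = {\<phi> \<in> ext_nevanlinna. \<forall>i\<in>I. julia_bound \<phi> (x i) (c i) (e i) (g i)}"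

lemma boundary_pick_sym: "boundary_pick x c e g i j = boundary_pick x c e g j i"
proof -
  have "(a - b) / (p - q) = (b - a) / (q - p)" for a b p q :: real
    by (metis minus_diff_eq minus_divide_divide)
  from this[of "e i * c j" "c i * e j" "x j" "x i"] show ?thesis
    unfolding boundary_pick_def by (simp add: mult.commute)
qed

text \<open>The end of the recursion with no nodes left; the real constants suffice.\<close>

lemma infinite_ext_nevanlinna: "infinite ext_nevanlinna"
proof -
  let ?k = "\<lambda>a::real. Some (restrict (\<lambda>_. complex_of_real a) upper_half_plane)"
  have "inj ?k"
  proof (rule injI)
    fix a b assume "?k a = ?k b"
    then have "restrict (\<lambda>_. complex_of_real a) upper_half_plane \<i> =
        restrict (\<lambda>_. complex_of_real b) upper_half_plane \<i>" by simp
    then show "a = b" by simp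
  qed
  then have "infinite (range ?k)"
    using infinite_UNIV_char_0 finite_imageD by blast
  moreover have "range ?k \<subseteq> ext_nevanlinna"
    by (auto intro!: restrict_in_nevanlinna)
  ultimately show ?thesis
    using infinite_super by blast
qed

section \<open>Bijections between solution sets and the Schur step\<close>

text \<open>The map \<phi> -> -1 / (\<phi> - a) sends the value \<open>a\<close> to \<infinity>, and
  its matrix has determinant 1, so the bounds \<open>g\<close> stay the same.\<close>

lemma boundary_solutions_rotate:
  fixes a :: real
  shows "bij_betw (\<lambda>\<phi>. ext_neg_inv (ext_add (\<lambda>_. of_real (- a)) \<phi>))
    (boundary_solutions I x c e g) (boundary_solutions I x (\<lambda>i. - e i) (\<lambda>i. c i - a * e i) g)"
proof -
  let ?T = "\<lambda>\<phi>. ext_neg_inv (ext_add (\<lambda>_. of_real (- a)) \<phi>)"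
  let ?U = "\<lambda>\<psi>. ext_add (\<lambda>_. of_real a) (ext_neg_inv \<psi>)"
  have add: "ext_add (\<lambda>_. complex_of_real b) \<phi> \<in> ext_nevanlinna" if "\<phi> \<in> ext_nevanlinna" for \<phi> and b :: real
    using that by (rule ext_add_closed) auto
  have T: "?T \<phi> \<in> ext_nevanlinna" and UT: "?U (?T \<phi>) = \<phi>"
    and J: "julia_bound (?T \<phi>) y (- f) (d - a * f) h \<longleftrightarrow> julia_bound \<phi> y d f h"
    if "\<phi> \<in> ext_nevanlinna" for \<phi> y d f h
  proof -
    show "?T \<phi> \<in> ext_nevanlinna" using that by (intro ext_neg_inv_closed add)
    have "?U (?T \<phi>) = ext_add (\<lambda>_. of_real a) (ext_add (\<lambda>_. of_real (- a)) \<phi>)"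
      by (simp only: ext_neg_inv_involution[OF add[OF that]])
    then show "?U (?T \<phi>) = \<phi>" using ext_add_inverse[OF that] by simp
    show "julia_bound (?T \<phi>) y (- f) (d - a * f) h \<longleftrightarrow> julia_bound \<phi> y d f h"
      using julia_bound_ext_neg_inv[OF add[OF that, of "- a"], of y f "d - a * f" h]
        julia_bound_translate[of "- a" \<phi> y d f h] by simp
  qed
  have U: "?U \<psi> \<in> ext_nevanlinna" and TU: "?T (?U \<psi>) = \<psi>" if "\<psi> \<in> ext_nevanlinna" for \<psi>
  proof -
    show "?U \<psi> \<in> ext_nevanlinna" using that by (intro ext_neg_inv_closed add)
    have "ext_add (\<lambda>_. of_real (- a)) (?U \<psi>) = ext_neg_inv \<psi>"
      by (rule ext_add_inverse) (use ext_neg_inv_closed that in auto)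
    then show "?T (?U \<psi>) = \<psi>" using ext_neg_inv_involution[OF that] by simp
  qed
  show ?thesis
  proof (rule bij_betw_byWitness[where f' = ?U])
    show "?T ` boundary_solutions I x c e g \<subseteq> boundary_solutions I x (\<lambda>i. - e i) (\<lambda>i. c i - a * e i) g"
      using T J by (auto simp: boundary_solutions_def)
    show "?U ` boundary_solutions I x (\<lambda>i. - e i) (\<lambda>i. c i - a * e i) g \<subseteq> boundary_solutions I x c e g"
    proof
      fix \<phi> assume "\<phi> \<in> ?U ` boundary_solutions I x (\<lambda>i. - e i) (\<lambda>i. c i - a * e i) g"
      then obtain \<psi> where \<psi>: "\<phi> = ?U \<psi>" "\<psi> \<in> ext_nevanlinna"
          "\<forall>i\<in>I. julia_bound \<psi> (x i) (- e i) (c i - a * e i) (g i)"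
        by (auto simp: boundary_solutions_def)
      then have "\<phi> \<in> ext_nevanlinna" "?T \<phi> = \<psi>" using U TU by auto
      then show "\<phi> \<in> boundary_solutions I x c e g"
        using J \<psi>(3) by (auto simp: boundary_solutions_def)
    qed
  qed (use UT TU in \<open>auto simp: boundary_solutions_def\<close>)
qed

text \<open>The condition at \<open>k\<close> says exactly that the modified function is still in
  the class, so it disappears as a condition. The inverse map adds -\<kappa> / (z - x k), which has
  nonnegative imaginary part and therefore never leaves the class.\<close>

lemma boundary_solutions_remove_pole:
  fixes x c e g :: "'a \<Rightarrow> real"
  assumes inj: "inj_on x (insert k I)" and k: "k \<notin> I" and ce: "\<forall>i\<in>I. c i \<noteq> 0 \<or> e i \<noteq> 0"
    and ek: "e k = 0" and gk: "g k > 0"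
  defines "\<kappa> \<equiv> (c k)\<^sup>2 / g k"
  shows "bij_betw (ext_add (\<lambda>z. of_real \<kappa> / (z - of_real (x k))))
    (boundary_solutions (insert k I) x c e g)
    (boundary_solutions I x (\<lambda>i. c i + e i * \<kappa> / (x i - x k)) e (\<lambda>i. g i - (e i)\<^sup>2 * \<kappa> / (x i - x k)\<^sup>2))"
    (is "bij_betw (ext_add ?h) ?S ?S'")
proof -
  let ?h' = "\<lambda>z. of_real (- \<kappa>) / (z - of_real (x k))"
  have \<kappa>: "\<kappa> \<ge> 0" using gk by (simp add: \<kappa>_def)
  have ne: "x i \<noteq> x k" if "i \<in> I" for i
    using inj k that by (metis inj_on_eq_iff insertI1 insertI2)
  have h'_closed: "ext_add ?h' \<psi> \<in> ext_nevanlinna" if "\<psi> \<in> ext_nevanlinna" for \<psi>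
    using that
  proof (rule ext_add_closed)
    show "?h' holomorphic_on upper_half_plane" by (intro holomorphic_intros) auto
    show "Im (?h' z) \<ge> 0" if "Im z > 0" for z
      unfolding Im_real_over_diff using \<kappa> that by simp
  qed
  have at_k: "julia_bound \<phi> (x k) (c k) (e k) (g k) \<longleftrightarrow> ext_add ?h \<phi> \<in> ext_nevanlinna"
    if \<phi>: "\<phi> \<in> ext_nevanlinna" for \<phi>
  proof (cases \<phi>)
    case None
    then show ?thesis using ek gk by (simp add: julia_bound_def)
  next
    case (Some f)
    have "(c k)\<^sup>2 * Im z \<le> g k * Im (f z) * (cmod (z - of_real (x k)))\<^sup>2 \<longleftrightarrow>
        \<kappa> * Im z \<le> Im (f z) * (cmod (z - of_real (x k)))\<^sup>2" for z
      using gk by (simp add: \<kappa>_def divide_le_eq mult_ac)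
    then show ?thesis
      using \<phi> ek gk Some nevanlinna_add_pole_iff[of f \<kappa> "x k"]
      by (simp add: julia_bound_def nevanlinna_iff)
  qed
  have inv1: "ext_add ?h' (ext_add ?h \<phi>) = \<phi>" if "\<phi> \<in> ext_nevanlinna" for \<phi>
    using that by (rule ext_add_inverse) simp
  have inv2: "ext_add ?h (ext_add ?h' \<psi>) = \<psi>" if "\<psi> \<in> ext_nevanlinna" for \<psi>
    using that by (rule ext_add_inverse) simp
  have iff: "\<phi> \<in> ?S \<longleftrightarrow> ext_add ?h \<phi> \<in> ?S'" if \<phi>: "\<phi> \<in> ext_nevanlinna" for \<phi>
  proof (cases "ext_add ?h \<phi> \<in> ext_nevanlinna")
    case True
    then show ?thesis
      using at_k[OF \<phi>] \<phi> ce ne julia_bound_add_pole[OF \<phi> True]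
      by (simp add: boundary_solutions_def)
  next
    case False
    then show ?thesis
      using at_k[OF \<phi>] by (simp add: boundary_solutions_def)
  qed
  show ?thesis
  proof (rule bij_betw_byWitness[where f' = "ext_add ?h'"])
    show "ext_add ?h ` ?S \<subseteq> ?S'"
      using iff by (auto simp: boundary_solutions_def)
    show "ext_add ?h' ` ?S' \<subseteq> ?S"
    proof
      fix \<phi> assume "\<phi> \<in> ext_add ?h' ` ?S'"
      then obtain \<psi> where \<psi>: "\<psi> \<in> ?S'" "\<phi> = ext_add ?h' \<psi>" by blast
      then have "\<psi> \<in> ext_nevanlinna" by (simp add: boundary_solutions_def)
      then have "\<phi> \<in> ext_nevanlinna" "ext_add ?h \<phi> = \<psi>"
        using h'_closed inv2 \<psi>(2) by auto
      then show "\<phi> \<in> ?S" using iff \<psi>(1) by simp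
    qed
    show "\<forall>\<phi>\<in>?S. ext_add ?h' (ext_add ?h \<phi>) = \<phi>"
      using inv1 by (simp add: boundary_solutions_def)
    show "\<forall>\<psi>\<in>?S'. ext_add ?h (ext_add ?h' \<psi>) = \<psi>"
      using inv2 by (simp add: boundary_solutions_def)
  qed
qed

text \<open>With \<open>e k = 0\<close> the Schur correction is \<kappa> e_i e_j / ((x_i - x_k) (x_j
  - x_k)). Off the diagonal, partial fractions produce it from the shifted values; on the diagonal
  it is the change of \<open>g\<close>.\<close>

lemma boundary_pick_remove_pole:
  fixes x c e g :: "'a \<Rightarrow> real"
  assumes inj: "inj_on x (insert k I)" and k: "k \<notin> I" and ek: "e k = 0"
    and ij: "i \<in> I" "j \<in> I"
  defines "\<kappa> \<equiv> (c k)\<^sup>2 / g k" and "A \<equiv> boundary_pick x c e g"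
  shows "boundary_pick x (\<lambda>i. c i + e i * \<kappa> / (x i - x k)) e (\<lambda>i. g i - (e i)\<^sup>2 * \<kappa> / (x i - x k)\<^sup>2) i j =
    A i j - A k i * A k j / A k k"
proof -
  have ne: "x i - x k \<noteq> 0" "x j - x k \<noteq> 0" and ne': "x j - x i \<noteq> 0" if "i \<noteq> j"
    using inj_on_eq_iff[OF inj, of i k] inj_on_eq_iff[OF inj, of j k] inj_on_eq_iff[OF inj, of j i] k ij that
    by auto
  have Ak: "A k m = - c k * e m / (x m - x k)" if "m \<in> I" for m
    using k ek that by (auto simp: A_def boundary_pick_def)
  have Akk: "A k k = g k" by (simp add: A_def boundary_pick_def)
  have prod: "A k i * A k j / A k k = \<kappa> * (e i * e j / ((x i - x k) * (x j - x k)))"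
    unfolding Ak[OF ij(1)] Ak[OF ij(2)] Akk \<kappa>_def by (simp add: power2_eq_square mult_ac)
  show ?thesis
  proof (cases "i = j")
    case True
    then show ?thesis
      unfolding prod by (simp add: A_def boundary_pick_def power2_eq_square mult_ac)
  next
    case False
    have "(ei * (cj + ej * \<kappa> / q) - (ci + ei * \<kappa> / p) * ej) / (q - p) =
        (ei * cj - ci * ej) / (q - p) - \<kappa> * (ei * ej / (p * q))"
      if "p \<noteq> 0" "q \<noteq> 0" "q - p \<noteq> 0" for p q ei ej ci cj :: real
      using that by (simp add: divide_simps) (simp add: algebra_simps)
    from this[of "x i - x k" "x j - x k" "e i" "c j" "e j" "c i"]
    show ?thesis
      unfolding prod using False ne[OF False] ne'[OF False] by (simp add: A_def boundary_pick_def)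
  qed
qed

lemma sum_single:
  fixes f :: "'a \<Rightarrow> real"
  assumes "finite I" "k \<in> I" shows "(\<Sum>i\<in>I. f i * (if i = k then t else 0)) = f k * t"
  using assms by (simp add: if_distrib[of "\<lambda>t. _ * t"] cong: if_cong)

text \<open>
  The Schur algorithm at a node \<open>k\<close> where \<open>\<phi>\<close> is prescribed to be infinite: subtracting the
  largest admissible pole leaves a problem without the node \<open>k\<close>, whose Pick matrix is the
  Schur complement.
\<close>
lemma boundary_solutions_step:
  fixes x c e g :: "'a \<Rightarrow> real"
  assumes fin: "finite I" and k: "k \<notin> I" and inj: "inj_on x (insert k I)"
    and ce: "\<forall>i\<in>insert k I. c i \<noteq> 0 \<or> e i \<noteq> 0" and ek: "e k = 0"
    and IH: "\<And>c e g. \<forall>i\<in>I. c i \<noteq> 0 \<or> e i \<noteq> 0 \<Longrightarrow>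
      solution_trichotomy (boundary_solutions I x c e g)
        (psd_on I (boundary_pick x c e g)) (nonsingular_on I (boundary_pick x c e g))"
  shows "solution_trichotomy (boundary_solutions (insert k I) x c e g)
    (psd_on (insert k I) (boundary_pick x c e g)) (nonsingular_on (insert k I) (boundary_pick x c e g))"
proof -
  define A where "A = boundary_pick x c e g"
  have ck: "c k \<noteq> 0" using ce ek by simp
  have Akk: "A k k = g k" by (simp add: A_def boundary_pick_def)
  have sym: "A i k = A k i" for i
    unfolding A_def by (rule boundary_pick_sym)
  have Ak: "A k m = - c k * e m / (x m - x k)" if "m \<in> I" for m
    using k ek that by (auto simp: A_def boundary_pick_def)
  have diag: "A i i = g i" for i by (simp add: A_def boundary_pick_def)
  have diag_nonneg: "g i \<ge> 0" if psd: "psd_on (insert k I) A" and i: "i \<in> insert k I" for i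
  proof -
    define v :: "'a \<Rightarrow> real" where "v = (\<lambda>j. if j = i then 1 else 0)"
    have "0 \<le> (\<Sum>m\<in>insert k I. \<Sum>j\<in>insert k I. A m j * v m * v j)"
      by (rule psd[unfolded psd_on_def, THEN spec])
    also have "\<dots> = (\<Sum>m\<in>insert k I. (A m i * 1) * v m)"
    proof (intro sum.cong refl)
      fix m
      show "(\<Sum>j\<in>insert k I. A m j * v m * v j) = (A m i * 1) * v m"
        unfolding v_def using sum_single[of "insert k I" i "\<lambda>j. A m j * (if m = i then 1 else 0)" 1] fin i by simp
    qed
    also have "\<dots> = g i"
      unfolding v_def using sum_single[of "insert k I" i "\<lambda>m. A m i * 1" 1] fin i by (simp add: diag)
    finally show ?thesis .
  qed
  consider "g k < 0" | "g k = 0" | "g k > 0" by linarith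
  then have "solution_trichotomy (boundary_solutions (insert k I) x c e g)
      (psd_on (insert k I) A) (nonsingular_on (insert k I) A)"
  proof cases
    case 1
    then have "boundary_solutions (insert k I) x c e g = {}"
      by (auto simp: boundary_solutions_def julia_bound_def split: option.splits)
    moreover have "\<not> psd_on (insert k I) A"
      using diag_nonneg[of k] 1 by auto
    ultimately show ?thesis by (simp add: solution_trichotomy_def)
  next
    \<comment> \<open>The bound at \<open>k\<close> now reads (c k)^2 Im z \<le> 0 for a finite
      function, so \<infinity> is the only candidate; it solves the problem iff every other value is
      infinite as well and no bound is negative.\<close>
    case 2
    have only_None: "\<phi> = None" if "julia_bound \<phi> (x k) (c k) (e k) (g k)" for \<phi>
    proof (rule ccontr)
      assume "\<phi> \<noteq> None"
      with that have "c k = 0"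
        using 2 ek by (auto simp: julia_bound_def all_upper_half_plane_mult_le_0_iff)
      then show False using ck by simp
    qed
    define good where "good \<longleftrightarrow> (\<forall>i\<in>I. e i = 0 \<and> g i \<ge> 0)"
    have S: "boundary_solutions (insert k I) x c e g = (if good then {None} else {})"
    proof -
      have "boundary_solutions (insert k I) x c e g \<subseteq> {None}"
      proof
        fix \<phi> assume "\<phi> \<in> boundary_solutions (insert k I) x c e g"
        then have "julia_bound \<phi> (x k) (c k) (e k) (g k)" by (simp add: boundary_solutions_def)
        then show "\<phi> \<in> {None}" using only_None by simp
      qed
      moreover have "None \<in> boundary_solutions (insert k I) x c e g \<longleftrightarrow> good"
        using 2 ek by (simp add: boundary_solutions_def julia_bound_def good_def)
      ultimately show ?thesis by auto
    qed
    have psd: "psd_on (insert k I) A \<longleftrightarrow> good"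
    proof
      assume psd: "psd_on (insert k I) A"
      have "e i = 0" if i: "i \<in> I" for i
      proof -
        \<comment> \<open>The form at the vector with entry \<open>t\<close> at \<open>k\<close> and
          1 at \<open>i\<close>. As the diagonal entry at \<open>k\<close> is zero, it is affine in
          \<open>t\<close>, so nonnegativity forces the slope to vanish.\<close>
        have "0 \<le> 2 * t * A k i + g i" for t
        proof -
          define v :: "'a \<Rightarrow> real" where "v = (\<lambda>j. if j = i then 1 else 0)(k := t)"
          have v: "v j = (if j = i then 1 else 0)" if "j \<in> I" for j
            using that k by (auto simp: v_def)
          have single: "(\<Sum>j\<in>I. f j * v j) = f i" for f :: "'a \<Rightarrow> real"
          proof -
            have "(\<Sum>j\<in>I. f j * v j) = (\<Sum>j\<in>I. f j * (if j = i then 1 else 0))"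
              by (intro sum.cong refl) (simp add: v)
            then show ?thesis using sum_single[of I i f 1] fin i by simp
          qed
          have "v i = 1" "v k = t" using i v by (auto simp: v_def)
          have "0 \<le> (\<Sum>m\<in>insert k I. \<Sum>j\<in>insert k I. A m j * v m * v j)"
            by (rule psd[unfolded psd_on_def, THEN spec])
          also have "\<dots> = A k k * (v k)\<^sup>2 + 2 * v k * A k i + (\<Sum>m\<in>I. A m i * v m)"
            unfolding quadratic_form_insert[of I k A, OF fin k sym] single ..
          also have "\<dots> = 2 * t * A k i + g i"
            unfolding single by (simp add: Akk 2 diag \<open>v k = t\<close>)
          finally show ?thesis .
        qed
        \<comment> \<open>At this \<open>t\<close> the affine expression would equal -1.\<close>
        from this[of "- (g i + 1) / (2 * A k i)"] have "A k i = 0"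
          by (cases "A k i = 0") (simp_all add: field_simps)
        moreover have "x i - x k \<noteq> 0" using inj_on_eq_iff[OF inj, of i k] k i by auto
        ultimately show ?thesis using Ak[OF i] ck by simp
      qed
      then show good using diag_nonneg[OF psd] by (simp add: good_def)
    next
      assume good: good
      then have off: "A i j = 0" if "i \<in> insert k I" "j \<in> insert k I" "i \<noteq> j" for i j
        using that ek by (auto simp: A_def boundary_pick_def good_def)
      have "(\<Sum>i\<in>insert k I. \<Sum>j\<in>insert k I. A i j * v i * v j) = (\<Sum>i\<in>insert k I. g i * (v i)\<^sup>2)" for v
      proof (intro sum.cong refl)
        fix i assume i: "i \<in> insert k I"
        have "(\<Sum>j\<in>insert k I. A i j * v i * v j) =
            (\<Sum>j\<in>insert k I. (v i * v j) * (if j = i then g i else 0))"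
          using off[OF i] by (intro sum.cong refl) (auto simp: diag)
        also have "\<dots> = (v i * v i) * g i"
          using fin i by (intro sum_single) auto
        finally show "(\<Sum>j\<in>insert k I. A i j * v i * v j) = g i * (v i)\<^sup>2"
          by (simp add: power2_eq_square)
      qed
      moreover have "g i \<ge> 0" if "i \<in> insert k I" for i
        using that good 2 by (auto simp: good_def)
      ultimately show "psd_on (insert k I) A"
        unfolding psd_on_def by (metis (no_types, lifting) mult_nonneg_nonneg sum_nonneg zero_le_power2)
    qed
    \<comment> \<open>Row and column \<open>k\<close> vanish, so the unit vector at \<open>k\<close>
      lies in the kernel: the unique solution occurs in the singular case.\<close>
    have "\<not> nonsingular_on (insert k I) A" if good
    proof
      assume ns: "nonsingular_on (insert k I) A"
      define v :: "'a \<Rightarrow> real" where "v = (\<lambda>j. if j = k then 1 else 0)"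
      have "(\<Sum>j\<in>insert k I. A i j * v j) = 0" if "i \<in> insert k I" for i
      proof -
        have "(\<Sum>j\<in>insert k I. A i j * v j) = A i k * 1"
          unfolding v_def using fin by (intro sum_single) auto
        also have "A i k = 0"
          using that \<open>good\<close> Ak 2 unfolding sym by (auto simp: Akk good_def)
        finally show ?thesis by simp
      qed
      then have "\<forall>i\<in>insert k I. (\<Sum>j\<in>insert k I. A i j * v j) = 0" by blast
      then have "\<forall>i\<in>insert k I. v i = 0"
        by (rule ns[unfolded nonsingular_on_def, THEN spec, THEN mp])
      then have "v k = 0" by blast
      then show False by (simp add: v_def)
    qed
    then show ?thesis
      unfolding S psd by (auto simp: solution_trichotomy_def)
  next
    case 3
    let ?\<kappa> = "(c k)\<^sup>2 / g k"
    let ?c = "\<lambda>i. c i + e i * ?\<kappa> / (x i - x k)" and ?g = "\<lambda>i. g i - (e i)\<^sup>2 * ?\<kappa> / (x i - x k)\<^sup>2"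
    have schur: "boundary_pick x ?c e ?g i j = A i j - A k i * A k j / A k k" if "i \<in> I" "j \<in> I" for i j
      unfolding A_def by (rule boundary_pick_remove_pole[of x k I e i j c g, OF inj k ek that])
    have pos: "A k k > 0" using 3 Akk by simp
    have "psd_on (insert k I) A \<longleftrightarrow> psd_on I (boundary_pick x ?c e ?g)"
      unfolding psd_on_schur[of I k A, OF fin k sym pos]
      by (rule psd_on_cong[symmetric]) (rule schur)
    moreover have "nonsingular_on (insert k I) A \<longleftrightarrow> nonsingular_on I (boundary_pick x ?c e ?g)"
      unfolding nonsingular_on_schur[of I k A, OF fin k sym pos]
      by (rule nonsingular_on_cong[symmetric]) (rule schur)
    moreover have "solution_trichotomy (boundary_solutions I x ?c e ?g)
        (psd_on I (boundary_pick x ?c e ?g)) (nonsingular_on I (boundary_pick x ?c e ?g))"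
    proof (rule IH)
      show "\<forall>i\<in>I. ?c i \<noteq> 0 \<or> e i \<noteq> 0" using ce by auto
    qed
    ultimately show ?thesis
      using solution_trichotomy_bij_betw[OF boundary_solutions_remove_pole[of x k I c e g]] inj k ce ek 3
      by simp
  qed
  then show ?thesis by (simp only: A_def)
qed

text \<open>Rotation and pole removal change the data at all remaining nodes, so the induction runs
  over arbitrary \<open>c\<close>, \<open>e\<close> and \<open>g\<close>; for the same reason no
  rotation has to be undone before the induction hypothesis is used.\<close>

theorem boundary_nevanlinna_pick:
  fixes x c e g :: "'a \<Rightarrow> real"
  assumes "finite I" "inj_on x I" "\<forall>i\<in>I. c i \<noteq> 0 \<or> e i \<noteq> 0"
  shows "solution_trichotomy (boundary_solutions I x c e g)
    (psd_on I (boundary_pick x c e g)) (nonsingular_on I (boundary_pick x c e g))"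
  using assms
proof (induction I arbitrary: c e g rule: finite_induct)
  case empty
  then show ?case
    using infinite_ext_nevanlinna infinite_imp_nonempty
    by (auto simp: solution_trichotomy_def boundary_solutions_def psd_on_def nonsingular_on_def)
next
  case (insert k I)
  have IH: "solution_trichotomy (boundary_solutions I x c e g)
      (psd_on I (boundary_pick x c e g)) (nonsingular_on I (boundary_pick x c e g))"
    if "\<forall>i\<in>I. c i \<noteq> 0 \<or> e i \<noteq> 0" for c e g
    using insert.IH insert.prems(1) that by simp
  show ?case
  proof (cases "e k = 0")
    case True
    show ?thesis
      by (rule boundary_solutions_step[OF insert.hyps insert.prems True IH])
  next
    case False
    \<comment> \<open>The prescribed value at \<open>k\<close>; rotating it to \<infinity> makes the
      new \<open>e k\<close> zero, as the Schur step requires.\<close>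
    define a where "a = c k / e k"
    let ?c = "\<lambda>i. - e i" and ?e = "\<lambda>i. c i - a * e i"
    have pick: "boundary_pick x ?c ?e g = boundary_pick x c e g"
      by (intro ext) (simp add: boundary_pick_def algebra_simps)
    have "solution_trichotomy (boundary_solutions (insert k I) x ?c ?e g)
        (psd_on (insert k I) (boundary_pick x ?c ?e g)) (nonsingular_on (insert k I) (boundary_pick x ?c ?e g))"
    proof (rule boundary_solutions_step[OF insert.hyps insert.prems(1) _ _ IH])
      show "\<forall>i\<in>insert k I. ?c i \<noteq> 0 \<or> ?e i \<noteq> 0" using insert.prems(2) by auto
      show "?e k = 0" using False by (simp add: a_def)
    qed
    then show ?thesis
      unfolding pick using solution_trichotomy_bij_betw[OF boundary_solutions_rotate] by blast
  qed
qed

subsection \<open>The inverse of the Pick matrix\<close>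

lemma row_times_mat_index:
  assumes "v \<in> carrier_vec n" "A \<in> carrier_mat n m" "j < m"
  shows "vec_index (row_times_mat v A) j = (\<Sum>i<n. vec_index v i * A $$ (i, j))"
proof -
  have "vec_index (row_times_mat v A) j = scalar_prod (Matrix.row (mat_of_row v) 0) (Matrix.col A j)"
    using assms unfolding row_times_mat_def by simp
  also have "\<dots> = (\<Sum>i<n. vec_index v i * A $$ (i, j))"
    using assms by (simp add: scalar_prod_def lessThan_atLeast0)
  finally show ?thesis .
qed

lemma mult_mat_index_sum:
  assumes "A \<in> carrier_mat n n" "B \<in> carrier_mat n n" "i < n" "j < n"
  shows "(A * B) $$ (i, j) = (\<Sum>a<n. A $$ (i, a) * B $$ (a, j))"
  using assms by (simp add: scalar_prod_def lessThan_atLeast0)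

lemma pick_matrix_carrier: "pick_matrix n l x w \<gamma> \<xi> \<in> carrier_mat n n"
  by (simp add: pick_matrix_def)

lemma pick_matrix_sym:
  assumes "i < n" "j < n"
  shows "pick_matrix n l x w \<gamma> \<xi> $$ (i, j) = pick_matrix n l x w \<gamma> \<xi> $$ (j, i)"
proof -
  have "(a - b) / (p - q) = (b - a) / (q - p)" for a b p q :: real
    by (metis minus_diff_eq minus_divide_divide)
  from this[of "w j" "w i" "x j" "x i"] show ?thesis
    using assms by (auto simp: pick_matrix_def)
qed

text \<open>All four blocks come from one equation, P X - X P = E^T C - C^T E with X = diag(x). It
  says nothing about the diagonal of P.\<close>

lemma pick_matrix_displacement:
  assumes "interpolation_data n l x \<xi>" "i < n" "j < n"
  shows "pick_matrix n l x w \<gamma> \<xi> $$ (i, j) * (x j - x i) =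
    vec_index (E_vec n l) i * vec_index (C_vec n l w \<xi>) j - vec_index (C_vec n l w \<xi>) i * vec_index (E_vec n l) j"
proof -
  have ne: "x j - x i \<noteq> 0" "x i - x j \<noteq> 0" if "i \<noteq> j"
    using assms that by (auto simp: interpolation_data_def dest: inj_onD)
  have neg: "a / (x i - x j) * (x j - x i) = - a" if "i \<noteq> j" for a
    using ne[OF that] by (simp add: divide_simps) (simp add: algebra_simps)
  show ?thesis
    using assms ne neg[of "\<xi> i"] by (cases "i = j") (auto simp: pick_matrix_def E_vec_def C_vec_def)
qed

text \<open>Inversion reverses the sign of the displacement: this is why the negative of
  \<open>Q\<close> is a Pick matrix for the data \<open>c\<close>, \<open>e\<close>, and why
  negative semidefiniteness is the criterion.\<close>

lemma inverse_pick_matrix: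
  fixes x w \<gamma> \<xi> :: "nat \<Rightarrow> real" and Q :: "real mat"
  assumes data: "interpolation_data n l x \<xi>"
    and Q: "Q \<in> carrier_mat n n"
    and right: "inverts_mat (pick_matrix n l x w \<gamma> \<xi>) Q"
    and left: "inverts_mat Q (pick_matrix n l x w \<gamma> \<xi>)"
  defines "c \<equiv> \<lambda>i. vec_index (row_times_mat (C_vec n l w \<xi>) Q) i"
    and "e \<equiv> \<lambda>i. vec_index (row_times_mat (E_vec n l) Q) i"
  shows inverse_pick_matrix_sym: "\<And>i j. i < n \<Longrightarrow> j < n \<Longrightarrow> Q $$ (i, j) = Q $$ (j, i)"
    and inverse_pick_matrix_displacement:
      "\<And>i j. i < n \<Longrightarrow> j < n \<Longrightarrow> Q $$ (i, j) * (x i - x j) = e i * c j - c i * e j"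
    and inverse_pick_matrix_nonzero: "\<And>i. i < n \<Longrightarrow> c i \<noteq> 0 \<or> e i \<noteq> 0"
proof -
  define P where "P = pick_matrix n l x w \<gamma> \<xi>"
  define C where "C = (\<lambda>i. vec_index (C_vec n l w \<xi>) i)"
  define E where "E = (\<lambda>i. vec_index (E_vec n l) i)"
  have P: "P \<in> carrier_mat n n" unfolding P_def by (rule pick_matrix_carrier)
  have PQ: "P * Q = 1\<^sub>m n" and QP: "Q * P = 1\<^sub>m n"
    using right left P Q by (auto simp: inverts_mat_def P_def[symmetric])
  have PQ_sum: "(\<Sum>b<n. P $$ (i, b) * Q $$ (b, j)) = (if i = j then 1 else 0)"
    and QP_sum: "(\<Sum>b<n. Q $$ (i, b) * P $$ (b, j)) = (if i = j then 1 else 0)" if "i < n" "j < n" for i j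
    using mult_mat_index_sum[OF P Q that] mult_mat_index_sum[OF Q P that] that PQ QP by simp_all
  have C: "c j = (\<Sum>i<n. C i * Q $$ (i, j))" and E: "e j = (\<Sum>i<n. E i * Q $$ (i, j))" if "j < n" for j
    unfolding c_def e_def C_def E_def
    by (rule row_times_mat_index[OF _ Q that]; simp add: C_vec_def E_vec_def)+
  have "transpose_mat P = P"
    using P pick_matrix_sym by (intro eq_matI) (auto simp: P_def)
  \<comment> \<open>By symmetry of \<open>P\<close>, the transpose of \<open>Q\<close> is a left
    inverse too, and left and right inverses coincide.\<close>
  then have "transpose_mat Q * P = transpose_mat (P * Q)"
    using transpose_mult[OF P Q] by simp
  then have "transpose_mat Q * P = 1\<^sub>m n" by (simp add: PQ)
  moreover have QT: "transpose_mat Q \<in> carrier_mat n n"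
    using Q by simp
  ultimately have "transpose_mat Q * (P * Q) = Q"
    using assoc_mult_mat[OF QT P Q] Q by simp
  then have "transpose_mat Q = Q"
    using QT by (simp add: PQ)
  then show sym: "Q $$ (i, j) = Q $$ (j, i)" if "i < n" "j < n" for i j
    using Q that index_transpose_mat(1)[of i Q j] by simp
  \<comment> \<open>Multiplying the displacement equation by \<open>Q\<close> on both sides gives X
    Q - Q X = e^T c - c^T e; this is its entry (i, j).\<close>
  show disp: "Q $$ (i, j) * (x i - x j) = e i * c j - c i * e j" if ij: "i < n" "j < n" for i j
  proof -
    have "e i * c j - c i * e j = (\<Sum>a<n. \<Sum>b<n. Q $$ (i, a) * (P $$ (a, b) * (x b - x a)) * Q $$ (b, j))"
    proof -
      have "e i * c j = (\<Sum>a<n. \<Sum>b<n. Q $$ (i, a) * (E a * C b) * Q $$ (b, j))"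
        unfolding E[OF ij(1)] C[OF ij(2)] sum_product
        by (intro sum.cong refl) (simp add: sym[OF ij(1)] mult_ac)
      moreover have "c i * e j = (\<Sum>a<n. \<Sum>b<n. Q $$ (i, a) * (C a * E b) * Q $$ (b, j))"
        unfolding C[OF ij(1)] E[OF ij(2)] sum_product
        by (intro sum.cong refl) (simp add: sym[OF ij(1)] mult_ac)
      ultimately have "e i * c j - c i * e j =
          (\<Sum>a<n. \<Sum>b<n. Q $$ (i, a) * (E a * C b - C a * E b) * Q $$ (b, j))"
        by (simp add: sum_subtractf left_diff_distrib right_diff_distrib)
      also have "\<dots> = (\<Sum>a<n. \<Sum>b<n. Q $$ (i, a) * (P $$ (a, b) * (x b - x a)) * Q $$ (b, j))"
        unfolding P_def C_def E_def
        by (intro sum.cong refl) (simp add: pick_matrix_displacement[OF data])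
      finally show ?thesis .
    qed
    also have "\<dots> = (\<Sum>a<n. \<Sum>b<n. Q $$ (i, a) * P $$ (a, b) * (x b * Q $$ (b, j)))
        - (\<Sum>a<n. \<Sum>b<n. (Q $$ (i, a) * x a) * (P $$ (a, b) * Q $$ (b, j)))"
      by (simp add: sum_subtractf[symmetric] algebra_simps)
    also have "(\<Sum>a<n. \<Sum>b<n. Q $$ (i, a) * P $$ (a, b) * (x b * Q $$ (b, j))) =
        (\<Sum>b<n. (\<Sum>a<n. Q $$ (i, a) * P $$ (a, b)) * (x b * Q $$ (b, j)))"
      unfolding sum_distrib_right by (rule sum.swap)
    also have "\<dots> = (\<Sum>b<n. (x b * Q $$ (b, j)) * (if b = i then 1 else 0))"
      by (intro sum.cong refl) (simp add: QP_sum[OF ij(1)])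
    also have "\<dots> = (x i * Q $$ (i, j)) * 1"
      using ij by (intro sum_single) auto
    also have "(\<Sum>a<n. \<Sum>b<n. (Q $$ (i, a) * x a) * (P $$ (a, b) * Q $$ (b, j))) =
        (\<Sum>a<n. (Q $$ (i, a) * x a) * (if a = j then 1 else 0))"
      unfolding sum_distrib_left[symmetric] by (intro sum.cong refl) (simp add: PQ_sum[OF _ ij(2)])
    also have "\<dots> = (Q $$ (i, j) * x j) * 1"
      using ij by (intro sum_single) auto
    finally show ?thesis by (simp add: algebra_simps)
  qed
  \<comment> \<open>If both vanished, the displacement would make column \<open>i\<close> of
    \<open>Q\<close> zero off the diagonal. Then C_i and E_i vanish too, although E_i = 1 at nodes
    of the first kind and C_i = \<xi>_i is nonzero at the others.\<close>
  show "c i \<noteq> 0 \<or> e i \<noteq> 0" if i: "i < n" for i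
  proof (rule ccontr)
    assume "\<not> ?thesis"
    then have ce: "c i = 0" "e i = 0" by auto
    have off: "Q $$ (a, i) = 0" if "a < n" "a \<noteq> i" for a
    proof -
      have "x a \<noteq> x i"
        using data i that by (auto simp: interpolation_data_def dest: inj_onD)
      then show ?thesis
        using disp[OF that(1) i] ce by simp
    qed
    have col: "(\<Sum>a<n. f a * Q $$ (a, i)) = f i * Q $$ (i, i)" for f :: "nat \<Rightarrow> real"
    proof -
      have "(\<Sum>a<n. f a * Q $$ (a, i)) = (\<Sum>a<n. f a * (if a = i then Q $$ (i, i) else 0))"
        using off by (intro sum.cong refl) auto
      then show ?thesis using sum_single[of "{..<n}" i f "Q $$ (i, i)"] i by simp
    qed
    have "P $$ (i, i) * Q $$ (i, i) = 1"
      using PQ_sum[OF i i] col[of "\<lambda>a. P $$ (i, a)"] by simp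
    then have "Q $$ (i, i) \<noteq> 0" by auto
    then have "C i = 0" "E i = 0"
      using C[OF i] E[OF i] ce col[of C] col[of E] by auto
    then show False
      using data i by (auto simp: C_def E_def C_vec_def E_vec_def interpolation_data_def split: if_splits)
  qed
qed

section \<open>Matrix predicates as conditions on index sets\<close>

lemma invertible_mat_iff_det:
  fixes A :: "'a :: field mat"
  assumes A: "A \<in> carrier_mat n n"
  shows "invertible_mat A \<longleftrightarrow> Determinant.det A \<noteq> 0"
proof
  assume "invertible_mat A"
  then obtain B where B: "A * B = 1\<^sub>m n" "B * A = 1\<^sub>m (dim_row B)"
    using A by (auto simp: invertible_mat_def inverts_mat_def)
  \<comment> \<open>\<open>invertible_mat\<close> does not fix the dimensions of the inverse; they
    are read off from the two products.\<close>
  have "dim_col (A * B) = dim_col B" "dim_col (B * A) = dim_col A"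
    by (rule index_mult_mat(3))+
  then have "B \<in> carrier_mat n n"
    unfolding B using A by auto
  with B have "Determinant.det A * Determinant.det B = 1"
    using B(1) A det_mult[of A n B] by simp
  then show "Determinant.det A \<noteq> 0" by auto
next
  assume "Determinant.det A \<noteq> 0"
  then have "A \<in> Units (ring_mat TYPE('a) n ())"
    using A by (rule det_non_zero_imp_unit[rotated])
  then obtain B where "B \<in> carrier_mat n n" "A * B = 1\<^sub>m n" "B * A = 1\<^sub>m n"
    by (auto simp: Units_def ring_mat_def)
  then show "invertible_mat A"
    using A by (auto simp: invertible_mat_def inverts_mat_def)
qed

text \<open>The determinant links invertibility to a trivial kernel. For \<open>k = 0\<close> the
  empty matrix is invertible, in accordance with infinitely many solutions when no node is
  prescribed.\<close>

lemma invertible_mat_iff_nonsingular_on: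
  fixes a :: "nat \<Rightarrow> nat \<Rightarrow> real"
  shows "invertible_mat (Matrix.mat k k (\<lambda>(i, j). a i j)) \<longleftrightarrow> nonsingular_on {..<k} a"
proof -
  let ?A = "Matrix.mat k k (\<lambda>(i, j). a i j)"
  have prod: "vec_index (?A *\<^sub>v v) i = (\<Sum>j<k. a i j * vec_index v j)"
    if "v \<in> carrier_vec k" "i < k" for v i
    using that by (simp add: scalar_prod_def lessThan_atLeast0)
  have kernel: "?A *\<^sub>v v = 0\<^sub>v k \<longleftrightarrow> (\<forall>i\<in>{..<k}. (\<Sum>j<k. a i j * vec_index v j) = 0)"
    if "v \<in> carrier_vec k" for v
    using prod[OF that] by (auto simp: vec_eq_iff)
  have "invertible_mat ?A \<longleftrightarrow> Determinant.det ?A \<noteq> 0"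
    by (rule invertible_mat_iff_det[of _ k]) simp
  also have "\<dots> \<longleftrightarrow> (\<forall>v\<in>carrier_vec k. ?A *\<^sub>v v = 0\<^sub>v k \<longrightarrow> v = 0\<^sub>v k)"
    by (subst det_0_iff_vec_prod_zero_field[of _ k]) auto
  also have "\<dots> \<longleftrightarrow> nonsingular_on {..<k} a"
  proof
    assume ker: "\<forall>v\<in>carrier_vec k. ?A *\<^sub>v v = 0\<^sub>v k \<longrightarrow> v = 0\<^sub>v k"
    show "nonsingular_on {..<k} a"
      unfolding nonsingular_on_def
    proof (intro allI impI)
      fix v assume v: "\<forall>i\<in>{..<k}. (\<Sum>j<k. a i j * v j) = 0"
      have "(\<Sum>j<k. a i j * vec_index (Matrix.vec k v) j) = (\<Sum>j<k. a i j * v j)" for i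
        by (intro sum.cong refl) simp
      then have "?A *\<^sub>v Matrix.vec k v = 0\<^sub>v k"
        using kernel[of "Matrix.vec k v"] v by simp
      then have "Matrix.vec k v = 0\<^sub>v k"
        using ker by simp
      then show "\<forall>i\<in>{..<k}. v i = 0"
        by (auto simp: vec_eq_iff)
    qed
  next
    assume ns: "nonsingular_on {..<k} a"
    show "\<forall>v\<in>carrier_vec k. ?A *\<^sub>v v = 0\<^sub>v k \<longrightarrow> v = 0\<^sub>v k"
    proof (intro ballI impI)
      fix v assume v: "v \<in> carrier_vec k" "?A *\<^sub>v v = 0\<^sub>v k"
      then have "\<forall>i\<in>{..<k}. vec_index v i = 0"
        using ns[unfolded nonsingular_on_def, THEN spec[of _ "vec_index v"]] kernel[OF v(1)] by blast
      then show "v = 0\<^sub>v k"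
        using v(1) by (auto simp: vec_eq_iff)
    qed
  qed
  finally show ?thesis .
qed

lemma negative_semidefinite_iff_psd_on:
  fixes a :: "nat \<Rightarrow> nat \<Rightarrow> real"
  assumes sym: "\<And>i j. i < k \<Longrightarrow> j < k \<Longrightarrow> a i j = a j i"
  shows "negative_semidefinite (Matrix.mat k k (\<lambda>(i, j). a i j)) \<longleftrightarrow> psd_on {..<k} (\<lambda>i j. - a i j)"
proof -
  let ?A = "Matrix.mat k k (\<lambda>(i, j). a i j)"
  have "transpose_mat ?A = ?A"
    using sym by (intro eq_matI) auto
  have form: "scalar_prod v (?A *\<^sub>v v) =
      - (\<Sum>i<k. \<Sum>j<k. - a i j * vec_index v i * vec_index v j)" if "v \<in> carrier_vec k" for v
  proof -
    have "scalar_prod v (?A *\<^sub>v v) = (\<Sum>i<k. vec_index v i * (\<Sum>j<k. a i j * vec_index v j))"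
      using that by (simp add: scalar_prod_def lessThan_atLeast0)
    then show ?thesis
      by (simp add: sum_negf sum_distrib_left mult_ac)
  qed
  show ?thesis
  proof
    assume ns: "negative_semidefinite ?A"
    show "psd_on {..<k} (\<lambda>i j. - a i j)"
      unfolding psd_on_def
    proof
      fix v :: "nat \<Rightarrow> real"
      have "(\<Sum>i<k. \<Sum>j<k. - a i j * v i * v j) =
          (\<Sum>i<k. \<Sum>j<k. - a i j * vec_index (Matrix.vec k v) i * vec_index (Matrix.vec k v) j)"
        by (intro sum.cong refl) simp
      also have "\<dots> \<ge> 0"
      proof -
        have "scalar_prod (Matrix.vec k v) (?A *\<^sub>v Matrix.vec k v) \<le> 0"
          using ns unfolding negative_semidefinite_def by simp
        then show ?thesis
          unfolding form[OF vec_carrier] by linarith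
      qed
      finally show "0 \<le> (\<Sum>i<k. \<Sum>j<k. - a i j * v i * v j)" .
    qed
  next
    assume psd: "psd_on {..<k} (\<lambda>i j. - a i j)"
    have "scalar_prod v (?A *\<^sub>v v) \<le> 0" if "v \<in> carrier_vec k" for v
      unfolding form[OF that] using psd[unfolded psd_on_def, THEN spec[of _ "vec_index v"]] by simp
    then show "negative_semidefinite ?A"
      unfolding negative_semidefinite_def using \<open>transpose_mat ?A = ?A\<close> by simp
  qed
qed

lemma nonsingular_on_uminus: "nonsingular_on I (\<lambda>i j. - A i j) \<longleftrightarrow> nonsingular_on I A"
  by (simp add: nonsingular_on_def sum_negf)

theorem theorem2p13:
  fixes n l k :: nat
    and x w \<gamma> \<xi> :: "nat \<Rightarrow> real"
    and idx :: "nat \<Rightarrow> nat"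
    and Pinv \<P> :: "real mat"
    and S :: "(complex \<Rightarrow> complex) option set"
  assumes data: "interpolation_data n l x \<xi>"
    and Pinv_dim: "Pinv \<in> carrier_mat n n"
    and Pinv_right: "inverts_mat (pick_matrix n l x w \<gamma> \<xi>) Pinv"
    and Pinv_left: "inverts_mat Pinv (pick_matrix n l x w \<gamma> \<xi>)"
    and idx_range: "\<forall>\<alpha><k. idx \<alpha> < n"
    and idx_inj: "inj_on idx {..<k}"
  defines "\<P> \<equiv> Matrix.mat k k (\<lambda>(\<alpha>, \<beta>). Pinv $$ (idx \<alpha>, idx \<beta>))"
    and "S \<equiv> {\<phi> \<in> ext_nevanlinna. \<forall>\<alpha><k. let i = idx \<alpha> in
               cond_C46 (x i) (Pinv $$ (i, i))
                 (vec_index (row_times_mat (C_vec n l w \<xi>) Pinv) i)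
                 (vec_index (row_times_mat (E_vec n l) Pinv) i) \<phi>}"
  shows "((\<exists>\<phi>. \<phi> \<in> S) \<longleftrightarrow> negative_semidefinite \<P>) \<and>
         (negative_semidefinite \<P> \<longrightarrow>
            (invertible_mat \<P> \<longrightarrow> infinite S) \<and>
            (\<not> invertible_mat \<P> \<longrightarrow> (\<exists>!\<phi>. \<phi> \<in> S)))"
proof -
  define y where "y = (\<lambda>\<alpha>. x (idx \<alpha>))"
  define c where "c = (\<lambda>\<alpha>. vec_index (row_times_mat (C_vec n l w \<xi>) Pinv) (idx \<alpha>))"
  define e where "e = (\<lambda>\<alpha>. vec_index (row_times_mat (E_vec n l) Pinv) (idx \<alpha>))"
  define q where "q = (\<lambda>\<alpha> \<beta>. Pinv $$ (idx \<alpha>, idx \<beta>))"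
  \<comment> \<open>Displacement determines only the off-diagonal entries of the Pick matrix. Its
    diagonal consists of the prescribed bounds, which are the negatives of the diagonal entries of
    \<open>Pinv\<close>.\<close>
  define g where "g = (\<lambda>\<alpha>. - q \<alpha> \<alpha>)"
  note inverse = inverse_pick_matrix[OF data Pinv_dim Pinv_right Pinv_left]
  have q_sym: "q \<alpha> \<beta> = q \<beta> \<alpha>" if "\<alpha> < k" "\<beta> < k" for \<alpha> \<beta>
    using inverse(1) idx_range that by (simp add: q_def)
  have ce: "\<forall>\<alpha>\<in>{..<k}. c \<alpha> \<noteq> 0 \<or> e \<alpha> \<noteq> 0"
    using inverse(3) idx_range by (simp add: c_def e_def)
  have y_inj: "inj_on y {..<k}"
  proof (rule inj_onI)
    fix \<alpha> \<beta> assume "\<alpha> \<in> {..<k}" "\<beta> \<in> {..<k}" "y \<alpha> = y \<beta>"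
    then have "idx \<alpha> = idx \<beta>"
      using data idx_range by (auto simp: y_def interpolation_data_def dest: inj_onD)
    then show "\<alpha> = \<beta>"
      using idx_inj \<open>\<alpha> \<in> {..<k}\<close> \<open>\<beta> \<in> {..<k}\<close> by (auto dest: inj_onD)
  qed
  have pick: "boundary_pick y c e g \<alpha> \<beta> = - q \<alpha> \<beta>" if "\<alpha> \<in> {..<k}" "\<beta> \<in> {..<k}" for \<alpha> \<beta>
  proof (cases "\<alpha> = \<beta>")
    case False
    then have "y \<beta> - y \<alpha> \<noteq> 0"
      using y_inj that by (auto dest: inj_onD)
    moreover have "e \<alpha> * c \<beta> - c \<alpha> * e \<beta> = - q \<alpha> \<beta> * (y \<beta> - y \<alpha>)"
      using inverse(2)[of "idx \<alpha>" "idx \<beta>"] idx_range that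
      by (simp add: q_def y_def c_def e_def algebra_simps)
    ultimately show ?thesis
      using False by (simp add: boundary_pick_def)
  qed (simp add: boundary_pick_def g_def)
  have S: "S = boundary_solutions {..<k} y c e g"
    unfolding S_def boundary_solutions_def Let_def
  proof (intro Collect_cong conj_cong refl)
    fix \<phi> assume \<phi>: "\<phi> \<in> ext_nevanlinna"
    have "cond_C46 (x (idx \<alpha>)) (Pinv $$ (idx \<alpha>, idx \<alpha>)) (c \<alpha>) (e \<alpha>) \<phi> \<longleftrightarrow>
        julia_bound \<phi> (y \<alpha>) (c \<alpha>) (e \<alpha>) (g \<alpha>)" if "\<alpha> < k" for \<alpha>
      using cond_C46_iff_julia_bound[OF \<phi>] ce that by (simp add: y_def g_def q_def)
    then show "(\<forall>\<alpha><k. cond_C46 (x (idx \<alpha>)) (Pinv $$ (idx \<alpha>, idx \<alpha>))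
          (vec_index (row_times_mat (C_vec n l w \<xi>) Pinv) (idx \<alpha>))
          (vec_index (row_times_mat (E_vec n l) Pinv) (idx \<alpha>)) \<phi>) \<longleftrightarrow>
        (\<forall>\<alpha>\<in>{..<k}. julia_bound \<phi> (y \<alpha>) (c \<alpha>) (e \<alpha>) (g \<alpha>))"
      unfolding c_def e_def by auto
  qed
  have "negative_semidefinite \<P> \<longleftrightarrow> psd_on {..<k} (\<lambda>\<alpha> \<beta>. - q \<alpha> \<beta>)"
    unfolding \<P>_def using negative_semidefinite_iff_psd_on[of k q, OF q_sym] by (simp add: q_def)
  also have "\<dots> \<longleftrightarrow> psd_on {..<k} (boundary_pick y c e g)"
    by (rule psd_on_cong[symmetric]) (rule pick)
  finally have psd: "negative_semidefinite \<P> \<longleftrightarrow> psd_on {..<k} (boundary_pick y c e g)" .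
  have "invertible_mat \<P> \<longleftrightarrow> nonsingular_on {..<k} (\<lambda>\<alpha> \<beta>. - q \<alpha> \<beta>)"
    unfolding \<P>_def nonsingular_on_uminus invertible_mat_iff_nonsingular_on[symmetric] by (simp add: q_def)
  also have "\<dots> \<longleftrightarrow> nonsingular_on {..<k} (boundary_pick y c e g)"
    by (rule nonsingular_on_cong[symmetric]) (rule pick)
  finally have nonsing: "invertible_mat \<P> \<longleftrightarrow> nonsingular_on {..<k} (boundary_pick y c e g)" .
  show ?thesis
    using boundary_nevanlinna_pick[OF _ y_inj ce, of g]
    unfolding S psd nonsing solution_trichotomy_def by auto
qed

end
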